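(* Let $k$ be a field, $n\ge 0$ an integer, and let $T=\{1,2,\ldots,d\}$ be equipped with an arbitrary partial order $\le$. For every $d$-tuple $\mathbf Q=(Q_1,\ldots,Q_d)\in k^d$, the set $p_n^{(T)}$ of $T$-ramified partitions (where $a=(a_t)_{t\in T}$ is identified with $\bigotimes_{t\in T}a_t$) is a basis for a subalgebra of the tensor product algebra $\bigotimes_{t\in T}P_n(Q_t)$ of partition algebras.
   Context: Write $\underline n=\{1,\ldots,n\}$, and let $\underline n'=\{1',\ldots,n'\}$, $\underline n''=\{1'',\ldots,n''\}$ be disjoint copies of it. For a set $U$, $\mathbf E(U)$ is the set of partitions of $U$, identified with equivalence relations on $U$. Put $p_n=\mathbf E(\underline n\cup\underline n')$. Partition algebra: for $Q\in k$, $P_n(Q)$ is the $k$-vector space with basis $p_n$ and the following bilinear product. For $a,b\in p_n$ let $b^{+}$ be the partition of $\underline n'\cup\underline n''$ obtained from $b$ by renaming $i\mapsto i'$, $i'\mapsto i''$; let $d_u(ab)$ be the equivalence relation on $\underline n\cup\underline n'\cup\underline n''$ generated by $a$ and $b^{+}$; let $c(a,b)$ be the number of parts of $d_u(ab)$ contained in $\underline n'$; and let $d(ab)\in p_n$ be obtained by restricting $d_u(ab)$ to $\underline n\cup\underline n''$ and renaming $i''\mapsto i'$. Then $ab=Q^{c(a,b)}d(ab)$. This is a unital associative $k$-algebra. Refinement: for $a,b\in\mathbf E(U)$, $a$ is a refinement of $b$ if each part of $b$ is a union of parts of $a$. $T$-ramified partitions: $p_n^{(T)}$ is the set of tuples $a=(a_t)_{t\in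 T}\in\prod_{t\in T}p_n$ such that $t\le t'$ implies that $a_t$ is a refinement of $a_{t'}$. *)

theory Defs
  imports "Jordan_Normal_Form.Missing_VectorSpace" "HOL-Algebra.QuotRing" "HOL-Algebra.Subrings"
begin

section \<open>Partitions\<close>

text \<open>Partitions of \<open>U\<close> are represented by the corresponding equivalence relations \<open>a\<close> on \<open>U\<close>;
  the parts of \<open>a\<close> are the elements of the quotient \<open>U // a\<close>.\<close>

definition partitions :: "'a set \<Rightarrow> 'a rel set" where
  "partitions U = {a. equiv U a}"

definition refinement :: "'a set \<Rightarrow> 'a rel \<Rightarrow> 'a rel \<Rightarrow> bool" where
  "refinement U a b \<longleftrightarrow> (\<forall>B \<in> U // b. \<exists>S. S \<subseteq> U // a \<and> B = \<Union>S)"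

definition equiv_generated :: "'a set \<Rightarrow> 'a rel \<Rightarrow> 'a rel" where
  "equiv_generated U r = \<Inter>{s. equiv U s \<and> r \<subseteq> s}"

section \<open>Partition diagrams\<close>

text \<open>The elements of the disjoint union of $\{1,\ldots,n\}$, $\{1',\ldots,n'\}$ and
  $\{1'',\ldots,n''\}$.\<close>

datatype vertex = Unprimed nat | Primed nat | DPrimed nat

definition row0 :: "nat \<Rightarrow> vertex set" where "row0 n = Unprimed ` {1..n}"
definition row1 :: "nat \<Rightarrow> vertex set" where "row1 n = Primed ` {1..n}"
definition row2 :: "nat \<Rightarrow> vertex set" where "row2 n = DPrimed ` {1..n}"

definition diagrams :: "nat \<Rightarrow> vertex rel set" where
  "diagrams n = partitions (row0 n \<union> row1 n)"

text \<open>The renaming $i \mapsto i'$, $i' \mapsto i''$, and the renaming $i \mapsto i$,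
  $i'' \mapsto i'$ (the values at the remaining vertices are never used).\<close>

fun add_prime :: "vertex \<Rightarrow> vertex" where
  "add_prime (Unprimed i) = Primed i"
| "add_prime (Primed i) = DPrimed i"
| "add_prime (DPrimed i) = DPrimed i"

fun merge_primes :: "vertex \<Rightarrow> vertex" where
  "merge_primes (Unprimed i) = Unprimed i"
| "merge_primes (Primed i) = Primed i"
| "merge_primes (DPrimed i) = Primed i"

definition stack :: "nat \<Rightarrow> vertex rel \<Rightarrow> vertex rel \<Rightarrow> vertex rel" where
  "stack n a b = equiv_generated (row0 n \<union> row1 n \<union> row2 n) (a \<union> map_prod add_prime add_prime ` b)"

definition inner_parts :: "nat \<Rightarrow> vertex rel \<Rightarrow> vertex rel \<Rightarrow> nat" where
  "inner_parts n a b =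
     card {C \<in> (row0 n \<union> row1 n \<union> row2 n) // stack n a b. C \<subseteq> row1 n}"

definition diagram_comp :: "nat \<Rightarrow> vertex rel \<Rightarrow> vertex rel \<Rightarrow> vertex rel" where
  "diagram_comp n a b =
     map_prod merge_primes merge_primes `
       (stack n a b \<inter> (row0 n \<union> row2 n) \<times> (row0 n \<union> row2 n))"

text \<open>The diagram with parts $\{i,i'\}$, which is the unit of the partition algebra.\<close>

definition diagram_id :: "nat \<Rightarrow> vertex rel" where
  "diagram_id n = (\<Union>i\<in>{1..n}. {Unprimed i, Primed i} \<times> {Unprimed i, Primed i})"

section \<open>Algebras with a basis closed under multiplication up to scalars\<close>

definition supp :: "('k, 'm) ring_scheme \<Rightarrow> ('x \<Rightarrow> 'k) \<Rightarrow> 'x set" where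
  "supp K f = {x. f x \<noteq> \<zero>\<^bsub>K\<^esub>}"

definition basis_vec :: "('k, 'm) ring_scheme \<Rightarrow> 'x \<Rightarrow> 'x \<Rightarrow> 'k" where
  "basis_vec K x = (\<lambda>y. if y = x then \<one>\<^bsub>K\<^esub> else \<zero>\<^bsub>K\<^esub>)"

text \<open>The free module on \<open>X\<close>, whose elements are the finitely supported functions \<open>X \<rightarrow> K\<close> (extended
  by zero), with the bilinear product that sends a pair \<open>x, y\<close> of basis vectors to the multiple by
  \<open>w x y\<close> of the basis vector \<open>m x y\<close>, and with the basis vector \<open>u\<close> as unit.\<close>

definition twisted_algebra ::
  "('k, 'm) ring_scheme \<Rightarrow> 'x set \<Rightarrow> 'x \<Rightarrow> ('x \<Rightarrow> 'x \<Rightarrow> 'x) \<Rightarrow> ('x \<Rightarrow> 'x \<Rightarrow> 'k) \<Rightarrow> ('k, 'x \<Rightarrow> 'k) module"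
where
  "twisted_algebra K X u m w =
    \<lparr>carrier = {f. range f \<subseteq> carrier K \<and> finite (supp K f) \<and> supp K f \<subseteq> X},
     mult = (\<lambda>f g z. \<Oplus>\<^bsub>K\<^esub>x \<in> supp K f. \<Oplus>\<^bsub>K\<^esub>y \<in> supp K g.
               if m x y = z then f x \<otimes>\<^bsub>K\<^esub> g y \<otimes>\<^bsub>K\<^esub> w x y else \<zero>\<^bsub>K\<^esub>),
     one = basis_vec K u,
     zero = (\<lambda>_. \<zero>\<^bsub>K\<^esub>),
     add = (\<lambda>f g x. f x \<oplus>\<^bsub>K\<^esub> g x),
     smult = (\<lambda>c f x. c \<otimes>\<^bsub>K\<^esub> f x)\<rparr>"

definition partition_algebra ::
  "('k, 'm) ring_scheme \<Rightarrow> nat \<Rightarrow> 'k \<Rightarrow> ('k, vertex rel \<Rightarrow> 'k) module" where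
  "partition_algebra K n q =
     twisted_algebra K (diagrams n) (diagram_id n) (diagram_comp n)
       (\<lambda>a b. q [^]\<^bsub>K\<^esub> inner_parts n a b)"

lemma partition_algebra_mult_basis:
  assumes "field K" "q \<in> carrier K"
  shows "basis_vec K a \<otimes>\<^bsub>partition_algebra K n q\<^esub> basis_vec K b =
         (q [^]\<^bsub>K\<^esub> inner_parts n a b) \<odot>\<^bsub>partition_algebra K n q\<^esub> basis_vec K (diagram_comp n a b)"
proof -
  interpret field K by fact
  have supp: "supp K (basis_vec K x) = {x}" for x :: "vertex rel"
    by (auto simp: supp_def basis_vec_def)
  have bv: "basis_vec K x y = (if y = x then \<one>\<^bsub>K\<^esub> else \<zero>\<^bsub>K\<^esub>)" for x y :: "vertex rel"
    by (simp add: basis_vec_def)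
  show ?thesis
    using assms(2)
    by (auto simp: partition_algebra_def twisted_algebra_def supp bv
        fun_eq_iff Pi_def)
qed

section \<open>Tensor products of families of algebras\<close>

text \<open>The tensor product of the family \<open>A\<close> over \<open>I\<close> is the free module on the product of the
  carriers modulo the span of the multilinearity relations. The free module carries the product that
  multiplies tuples componentwise, and the tensor product inherits it.\<close>

definition tuple_algebra ::
  "('k, 'm) ring_scheme \<Rightarrow> 'i set \<Rightarrow> ('i \<Rightarrow> ('k, 'a, 'n) module_scheme) \<Rightarrow> ('k, ('i \<Rightarrow> 'a) \<Rightarrow> 'k) module"
where
  "tuple_algebra K I A =
     twisted_algebra K (\<Pi>\<^sub>E i\<in>I. carrier (A i)) (\<lambda>i\<in>I. \<one>\<^bsub>A i\<^esub>)
       (\<lambda>x y. \<lambda>i\<in>I. x i \<otimes>\<^bsub>A i\<^esub> y i) (\<lambda>_ _. \<one>\<^bsub>K\<^esub>)"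

definition multilinear_relations ::
  "('k, 'm) ring_scheme \<Rightarrow> 'i set \<Rightarrow> ('i \<Rightarrow> ('k, 'a, 'n) module_scheme) \<Rightarrow> (('i \<Rightarrow> 'a) \<Rightarrow> 'k) set"
where
  "multilinear_relations K I A =
     {basis_vec K (x(i := u \<oplus>\<^bsub>A i\<^esub> v))
        \<ominus>\<^bsub>tuple_algebra K I A\<^esub> (basis_vec K (x(i := u)) \<oplus>\<^bsub>tuple_algebra K I A\<^esub> basis_vec K (x(i := v)))
      | x i u v. x \<in> (\<Pi>\<^sub>E i\<in>I. carrier (A i)) \<and> i \<in> I \<and> u \<in> carrier (A i) \<and> v \<in> carrier (A i)}
   \<union> {basis_vec K (x(i := c \<odot>\<^bsub>A i\<^esub> u))
        \<ominus>\<^bsub>tuple_algebra K I A\<^esub> (c \<odot>\<^bsub>tuple_algebra K I A\<^esub> basis_vec K (x(i := u)))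
      | x i c u. x \<in> (\<Pi>\<^sub>E i\<in>I. carrier (A i)) \<and> i \<in> I \<and> c \<in> carrier K \<and> u \<in> carrier (A i)}"

definition tensor_kernel ::
  "('k, 'm) ring_scheme \<Rightarrow> 'i set \<Rightarrow> ('i \<Rightarrow> ('k, 'a, 'n) module_scheme) \<Rightarrow> (('i \<Rightarrow> 'a) \<Rightarrow> 'k) set"
where
  "tensor_kernel K I A =
     LinearCombinations.module.span K (tuple_algebra K I A) (multilinear_relations K I A)"

definition tensor_algebra ::
  "('k, 'm) ring_scheme \<Rightarrow> 'i set \<Rightarrow> ('i \<Rightarrow> ('k, 'a, 'n) module_scheme)
     \<Rightarrow> ('k, (('i \<Rightarrow> 'a) \<Rightarrow> 'k) set) module"
where
  "tensor_algebra K I A = ring.extend (tuple_algebra K I A Quot tensor_kernel K I A)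
     (module.fields (\<lambda>c S. \<Union>f\<in>S. tensor_kernel K I A +>\<^bsub>tuple_algebra K I A\<^esub>
                                     (c \<odot>\<^bsub>tuple_algebra K I A\<^esub> f)))"

definition pure_tensor ::
  "('k, 'm) ring_scheme \<Rightarrow> 'i set \<Rightarrow> ('i \<Rightarrow> ('k, 'a, 'n) module_scheme)
     \<Rightarrow> ('i \<Rightarrow> 'a) \<Rightarrow> (('i \<Rightarrow> 'a) \<Rightarrow> 'k) set"
where
  "pure_tensor K I A x = tensor_kernel K I A +>\<^bsub>tuple_algebra K I A\<^esub> basis_vec K x"

definition is_subalgebra ::
  "('k, 'm) ring_scheme \<Rightarrow> 'a set \<Rightarrow> ('k, 'a, 'n) module_scheme \<Rightarrow> bool" where
  "is_subalgebra K B A \<longleftrightarrow> VectorSpace.subspace K B A \<and> subring B A"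

section \<open>Ramified partitions\<close>

definition ramified :: "nat \<Rightarrow> 'i set \<Rightarrow> 'i rel \<Rightarrow> ('i \<Rightarrow> vertex rel) set" where
  "ramified n T r =
     {a \<in> T \<rightarrow>\<^sub>E diagrams n.
        \<forall>t\<in>T. \<forall>t'\<in>T. (t, t') \<in> r \<longrightarrow> refinement (row0 n \<union> row1 n) (a t) (a t')}"

text \<open>The tensor product of the basis elements of the partition algebras given by a tuple of
  diagrams.\<close>

definition diagram_tensor ::
  "('k, 'm) ring_scheme \<Rightarrow> nat \<Rightarrow> 'i set \<Rightarrow> ('i \<Rightarrow> 'k) \<Rightarrow> ('i \<Rightarrow> vertex rel)
     \<Rightarrow> (('i \<Rightarrow> vertex rel \<Rightarrow> 'k) \<Rightarrow> 'k) set"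
where
  "diagram_tensor K n T Q a =
     pure_tensor K T (\<lambda>t. partition_algebra K n (Q t)) (\<lambda>t\<in>T. basis_vec K (a t))"

end

theory Submission
  imports Defs
begin

text \<open>A ramified tuple of diagrams is one that is monotone in \<open>t\<close> with respect to inclusion of
  equivalence relations, and stacking two diagrams is monotone for inclusion; so a product of two
  ramified tuples is ramified up to a scalar. Linear independence in the tensor product is tested with
  products of coordinate functionals, which kill the multilinearity relations.\<close>

section \<open>Unital algebras without associativity\<close>

text \<open>The tensor product is a quotient of the free module on all tuples of vectors, so it
  comes without a basis from which coordinates could be read off. Independence is therefore shown by
  exclusion: for each ramified tuple some submodule of the quotient contains the tensors of all the
  others and misses its own; the same submodules show that distinct tuples give distinct tensors.
  Such a submodule is the image of the kernel of a functional on the free module, and because that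
  kernel contains the relations, membership of a pure tensor can be tested before passing to the
  quotient. For products to be defined on cosets, the span of the relations must be a two-sided
  ideal: multiplying a relation by a tuple gives a relation of the same form, and linearity does the
  rest. The parameters Q_t enter through the scalar in front of a product of tensors. It may be 0,
  since only closure of the span is at stake. \<open>bilinear_algebra\<close> collects the laws on
  which these closure arguments rest.\<close>

locale bilinear_algebra = Module.module K A for K (structure) and A (structure) +
  assumes mult_closed [simp, intro]:
      "\<lbrakk>x \<in> carrier A; y \<in> carrier A\<rbrakk> \<Longrightarrow> x \<otimes>\<^bsub>A\<^esub> y \<in> carrier A"
    and unit_closed [simp, intro]: "\<one>\<^bsub>A\<^esub> \<in> carrier A"
    and mult_l_distr: "\<lbrakk>x \<in> carrier A; y \<in> carrier A; z \<in> carrier A\<rbrakk>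
      \<Longrightarrow> (x \<oplus>\<^bsub>A\<^esub> y) \<otimes>\<^bsub>A\<^esub> z = x \<otimes>\<^bsub>A\<^esub> z \<oplus>\<^bsub>A\<^esub> y \<otimes>\<^bsub>A\<^esub> z"
    and mult_r_distr: "\<lbrakk>x \<in> carrier A; y \<in> carrier A; z \<in> carrier A\<rbrakk>
      \<Longrightarrow> z \<otimes>\<^bsub>A\<^esub> (x \<oplus>\<^bsub>A\<^esub> y) = z \<otimes>\<^bsub>A\<^esub> x \<oplus>\<^bsub>A\<^esub> z \<otimes>\<^bsub>A\<^esub> y"
    and mult_smult_l: "\<lbrakk>c \<in> carrier K; x \<in> carrier A; y \<in> carrier A\<rbrakk>
      \<Longrightarrow> (c \<odot>\<^bsub>A\<^esub> x) \<otimes>\<^bsub>A\<^esub> y = c \<odot>\<^bsub>A\<^esub> (x \<otimes>\<^bsub>A\<^esub> y)"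
    and mult_smult_r: "\<lbrakk>c \<in> carrier K; x \<in> carrier A; y \<in> carrier A\<rbrakk>
      \<Longrightarrow> x \<otimes>\<^bsub>A\<^esub> (c \<odot>\<^bsub>A\<^esub> y) = c \<odot>\<^bsub>A\<^esub> (x \<otimes>\<^bsub>A\<^esub> y)"
begin

text \<open>Read from right to left, this turns subtraction into addition and scalar multiplication,
  so that facts about differences follow from linearity.\<close>

lemma smult_neg_one: "x \<in> carrier A \<Longrightarrow> (\<ominus>\<^bsub>K\<^esub> \<one>\<^bsub>K\<^esub>) \<odot>\<^bsub>A\<^esub> x = \<ominus>\<^bsub>A\<^esub> x"
  by (simp add: smult_l_minus)

lemma mult_minus_l:
  assumes "x \<in> carrier A" "y \<in> carrier A" "z \<in> carrier A"
  shows "(x \<ominus>\<^bsub>A\<^esub> y) \<otimes>\<^bsub>A\<^esub> z = x \<otimes>\<^bsub>A\<^esub> z \<ominus>\<^bsub>A\<^esub> y \<otimes>\<^bsub>A\<^esub> z"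
  using assms by (simp add: M.minus_eq mult_l_distr mult_smult_l flip: smult_neg_one)

lemma mult_minus_r:
  assumes "x \<in> carrier A" "y \<in> carrier A" "z \<in> carrier A"
  shows "z \<otimes>\<^bsub>A\<^esub> (x \<ominus>\<^bsub>A\<^esub> y) = z \<otimes>\<^bsub>A\<^esub> x \<ominus>\<^bsub>A\<^esub> z \<otimes>\<^bsub>A\<^esub> y"
  using assms by (simp add: M.minus_eq mult_r_distr mult_smult_r flip: smult_neg_one)

lemma submodule_a_inv:
  assumes "submodule K N A" "x \<in> N"
  shows "\<ominus>\<^bsub>A\<^esub> x \<in> N"
proof -
  interpret N: submodule K N A by fact
  have "(\<ominus>\<^bsub>K\<^esub> \<one>\<^bsub>K\<^esub>) \<odot>\<^bsub>A\<^esub> x \<in> N"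
    using assms(2) by simp
  then show ?thesis
    using assms(2) N.subset smult_neg_one by (metis subsetD)
qed

lemma submodule_abelian_subgroup:
  assumes "submodule K N A"
  shows "abelian_subgroup N A"
proof (rule abelian_subgroupI3)
  interpret N: submodule K N A by fact
  show "additive_subgroup N A"
    using submodule_a_inv[OF assms] N.subset
    by (intro additive_subgroupI add.subgroupI) (auto intro: N.zero_closed)
qed (rule M.abelian_group_axioms)

text \<open>With one factor fixed, the elements whose product with it lies in the span form a
  submodule, which contains the span as soon as it contains \<open>P\<close>. This is applied to
  right factors with the left one in \<open>P\<close>, then to left factors with the right one in
  the span.\<close>

lemma mult_span:
  assumes P: "P \<subseteq> carrier A"
    and PP: "\<And>x y. x \<in> P \<Longrightarrow> y \<in> P \<Longrightarrow> x \<otimes>\<^bsub>A\<^esub> y \<in> span P"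
    and x: "x \<in> span P" and y: "y \<in> span P"
  shows "x \<otimes>\<^bsub>A\<^esub> y \<in> span P"
proof -
  interpret S: submodule K "span P" A
    using P by (rule span_is_submodule)
  have left: "p \<otimes>\<^bsub>A\<^esub> y \<in> span P" if p: "p \<in> P" for p
  proof -
    let ?L = "{y \<in> carrier A. p \<otimes>\<^bsub>A\<^esub> y \<in> span P}"
    have "submodule K ?L A"
    proof
      \<comment> \<open>The zero vector is 0 times itself, so the scalar law yields that its product
        with \<open>p\<close> is zero.\<close>
      have "p \<otimes>\<^bsub>A\<^esub> (\<zero>\<^bsub>K\<^esub> \<odot>\<^bsub>A\<^esub> \<zero>\<^bsub>A\<^esub>) = \<zero>\<^bsub>K\<^esub> \<odot>\<^bsub>A\<^esub> (p \<otimes>\<^bsub>A\<^esub> \<zero>\<^bsub>A\<^esub>)"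
        using p P by (intro mult_smult_r) auto
      then show "\<zero>\<^bsub>A\<^esub> \<in> ?L"
        using p P by auto
    qed (use p P in \<open>auto simp: mult_r_distr mult_smult_r module_axioms subset_iff\<close>)
    then have "span P \<subseteq> ?L"
      using P p PP by (intro span_is_subset) auto
    then show ?thesis
      using y by blast
  qed
  have yA: "y \<in> carrier A"
    using y S.subset by blast
  let ?R = "{x \<in> carrier A. x \<otimes>\<^bsub>A\<^esub> y \<in> span P}"
  have "submodule K ?R A"
  proof
    have "(\<zero>\<^bsub>K\<^esub> \<odot>\<^bsub>A\<^esub> \<zero>\<^bsub>A\<^esub>) \<otimes>\<^bsub>A\<^esub> y = \<zero>\<^bsub>K\<^esub> \<odot>\<^bsub>A\<^esub> (\<zero>\<^bsub>A\<^esub> \<otimes>\<^bsub>A\<^esub> y)"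
      using yA by (intro mult_smult_l) auto
    then show "\<zero>\<^bsub>A\<^esub> \<in> ?R"
      using yA by auto
  qed (use yA in \<open>auto simp: mult_l_distr mult_smult_l module_axioms subset_iff\<close>)
  then have "span P \<subseteq> ?R"
    using P left by (intro span_is_subset) auto
  then show ?thesis
    using x by blast
qed

end

text \<open>In a nontrivial relation, dividing by a nonzero coefficient puts its vector into the
  span of the others. A submodule that contains those others then contains this vector too, which
  \<open>sep\<close> forbids.\<close>

lemma (in vectorspace) lin_indpt_by_separating_submodules:
  assumes P: "P \<subseteq> carrier V"
    and sep: "\<And>p. p \<in> P \<Longrightarrow> \<exists>N. submodule K N V \<and> P - {p} \<subseteq> N \<and> p \<notin> N"
  shows "lin_indpt P"
proof
  assume "lin_dep P"
  then obtain S c v where S: "finite S" "S \<subseteq> P" "c \<in> S \<rightarrow> carrier K" "lincomb c S = \<zero>\<^bsub>V\<^esub>"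
    "v \<in> S" "c v \<noteq> \<zero>\<^bsub>K\<^esub>"
    unfolding lin_dep_def by blast
  then have v: "v \<in> span (S - {v})"
    using P by (intro lincomb_isolate(2)) auto
  obtain N where N: "submodule K N V" "P - {v} \<subseteq> N" "v \<notin> N"
    using sep S by blast
  have "span (S - {v}) \<subseteq> N"
    using N S by (intro span_is_subset) auto
  then show False
    using v N by blast
qed

text \<open>The witness is the span of \<open>P\<close>. The scalar \<open>c\<close> is allowed to
  be 0, which leaves room for vanishing parameters of the partition algebras.\<close>

lemma span_subalgebra_with_basis:
  assumes "field K" and "bilinear_algebra K A" and P: "P \<subseteq> carrier A"
    and one: "\<one>\<^bsub>A\<^esub> \<in> P"
    and mult: "\<And>x y. x \<in> P \<Longrightarrow> y \<in> P \<Longrightarrow> \<exists>c \<in> carrier K. \<exists>z \<in> P. x \<otimes>\<^bsub>A\<^esub> y = c \<odot>\<^bsub>A\<^esub> z"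
    and sep: "\<And>p. p \<in> P \<Longrightarrow> \<exists>N. submodule K N A \<and> P - {p} \<subseteq> N \<and> p \<notin> N"
  shows "\<exists>B. is_subalgebra K B A \<and> vectorspace.basis K (A\<lparr>carrier := B\<rparr>) P"
proof -
  interpret bilinear_algebra K A by fact
  interpret V: vectorspace K A
    using assms(1) module_axioms by (simp add: vectorspace_def)
  interpret S: submodule K "span P" A
    using P by (rule span_is_submodule)
  have PS: "P \<subseteq> span P"
    using P by (rule in_own_span)
  have sub: "VectorSpace.subspace K (span P) A"
    using P by (rule V.span_is_subspace)
  have "x \<otimes>\<^bsub>A\<^esub> y \<in> span P" if "x \<in> P" "y \<in> P" for x y
    using mult[OF that] PS by auto
  then have m: "x \<otimes>\<^bsub>A\<^esub> y \<in> span P" if "x \<in> span P" "y \<in> span P" for x y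
    using mult_span[OF P] that by blast
  interpret N: abelian_subgroup "span P" A
    using S.submodule_axioms by (rule submodule_abelian_subgroup)
  have "subring (span P) A"
    using N.a_subgroup S.subset m one PS
    by (intro subring.intro submonoid.intro) auto
  moreover interpret B: vectorspace K "A\<lparr>carrier := span P\<rparr>"
    using sub by (rule V.subspace_is_vs)
  \<comment> \<open>Span and linear dependence of \<open>P\<close> are the same computed in the
    submodule \<open>span P\<close> as in \<open>A\<close>.\<close>
  have "B.basis P"
    unfolding B.basis_def
    using V.lin_indpt_by_separating_submodules[OF P sep] PS
      span_li_not_depend[OF PS S.submodule_axioms] by simp
  ultimately show ?thesis
    using sub unfolding is_subalgebra_def by blast
qed

section \<open>Refinement and composition of diagrams\<close>

text \<open>Equivalence relations are stable under intersection. The assumption on \<open>r\<close>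
  puts \<open>U \<times> U\<close> into the family; this bounds the intersection, which for an empty
  family would be the universal relation of the type.\<close>

lemma equiv_generated_equiv:
  assumes "r \<subseteq> U \<times> U"
  shows "equiv U (equiv_generated U r)"
proof -
  have U: "U \<times> U \<in> {s. equiv U s \<and> r \<subseteq> s}"
    using assms by (simp add: equiv_def refl_on_def sym_def trans_def)
  show ?thesis
    unfolding equiv_generated_def
  proof (intro equivI refl_onI symI transI InterI)
    show "\<Inter>{s. equiv U s \<and> r \<subseteq> s} \<subseteq> U \<times> U"
      using U by (rule Inter_lower)
  next
    fix x s assume "x \<in> U" "s \<in> {s. equiv U s \<and> r \<subseteq> s}"
    then show "(x, x) \<in> s"
      by (simp add: equiv_def refl_on_def)
  next
    fix x y s assume "(x, y) \<in> \<Inter>{s. equiv U s \<and> r \<subseteq> s}" and s: "s \<in> {s. equiv U s \<and> r \<subseteq> s}"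
    then have "(x, y) \<in> s"
      by (rule InterD)
    then show "(y, x) \<in> s"
      using s by (simp add: equiv_def sym_def)
  next
    fix x y z s assume xy: "(x, y) \<in> \<Inter>{s. equiv U s \<and> r \<subseteq> s}"
      and yz: "(y, z) \<in> \<Inter>{s. equiv U s \<and> r \<subseteq> s}" and s: "s \<in> {s. equiv U s \<and> r \<subseteq> s}"
    have "(x, y) \<in> s" "(y, z) \<in> s"
      using InterD[OF xy s] InterD[OF yz s] .
    moreover have "trans s"
      using s by (simp add: equiv_def)
    ultimately show "(x, z) \<in> s"
      by (blast dest: transD)
  qed
qed

lemma equiv_generated_mono: "r \<subseteq> r' \<Longrightarrow> equiv_generated U r \<subseteq> equiv_generated U r'"
  unfolding equiv_generated_def by blast

lemma equiv_restrict:
  assumes "equiv U s" "V \<subseteq> U"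
  shows "equiv V (s \<inter> V \<times> V)"
  using assms unfolding equiv_def refl_on_def sym_def trans_def by blast

text \<open>Injectivity serves transitivity: two image pairs that meet in a point must come from
  pairs of \<open>s\<close> that meet in a point.\<close>

lemma equiv_map_prod:
  assumes "equiv U s" "inj_on f U"
  shows "equiv (f ` U) (map_prod f f ` s)"
proof -
  have sU: "s \<subseteq> U \<times> U" and rs: "refl_on U s" "sym s" "trans s"
    using assms(1) by (auto simp: equiv_def)
  show ?thesis
  proof (intro equivI refl_onI symI transI)
    fix x y z assume "(x, y) \<in> map_prod f f ` s" "(y, z) \<in> map_prod f f ` s"
    then obtain a b b' c where *: "(a, b) \<in> s" "(b', c) \<in> s" "x = f a" "y = f b" "y = f b'" "z = f c"
      by auto
    then have "b = b'"
      using assms(2) sU by (auto dest: inj_onD)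
    then show "(x, z) \<in> map_prod f f ` s"
      using * rs(3) by (auto dest: transD)
  qed (use sU rs in \<open>auto dest: refl_onD symD\<close>)
qed

lemma quotient_eq_class:
  assumes "equiv U s" "C \<in> U // s" "x \<in> C"
  shows "C = s `` {x}" "x \<in> U"
proof -
  obtain z where z: "C = s `` {z}"
    using assms(2) by (rule quotientE)
  with assms(3) have "(z, x) \<in> s"
    by simp
  then show "C = s `` {x}" "x \<in> U"
    using equiv_class_eq[OF assms(1)] z assms(1) by (simp, auto simp: equiv_def)
qed

text \<open>Inclusion passes through generated relations and images, whereas unions of parts are
  hard to follow there. If \<open>B\<close> is a part of \<open>b\<close> and x is in
  \<open>B\<close>, then a union of parts of \<open>a\<close> equal to \<open>B\<close> must use the
  \<open>a\<close>-class of x. Conversely, \<open>B\<close> is the union of all parts of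
  \<open>a\<close> inside it.\<close>

lemma refinement_iff_subset:
  assumes a: "equiv U a" and b: "equiv U b"
  shows "refinement U a b \<longleftrightarrow> a \<subseteq> b"
proof
  assume ref: "refinement U a b"
  show "a \<subseteq> b"
  proof (rule subrelI)
    fix x y assume xy: "(x, y) \<in> a"
    then have xU: "x \<in> U"
      using a unfolding equiv_def by fast
    have "b `` {x} \<in> U // b"
      using xU by (rule quotientI)
    with ref obtain S where S: "S \<subseteq> U // a" "b `` {x} = \<Union>S"
      unfolding refinement_def by metis
    have "x \<in> \<Union>S"
      unfolding S(2)[symmetric] using b xU by (rule equiv_class_self)
    then obtain C where C: "C \<in> S" "x \<in> C"
      by (rule UnionE)
    have "C = a `` {x}"
      using a subsetD[OF S(1) C(1)] C(2) by (rule quotient_eq_class)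
    then have "y \<in> C"
      using xy by simp
    then have "y \<in> b `` {x}"
      unfolding S(2) using C(1) by (intro UnionI)
    then show "(x, y) \<in> b"
      by simp
  qed
next
  assume ab: "a \<subseteq> b"
  show "refinement U a b"
    unfolding refinement_def
  proof
    fix B assume B: "B \<in> U // b"
    have "B = \<Union>{C \<in> U // a. C \<subseteq> B}"
    proof (intro equalityI subsetI)
      fix x assume x: "x \<in> B"
      have xU: "x \<in> U" and Bx: "B = b `` {x}"
        using quotient_eq_class[OF b B x] by simp_all
      have "a `` {x} \<in> {C \<in> U // a. C \<subseteq> B}"
        using ab quotientI[OF xU] unfolding Bx by auto
      then show "x \<in> \<Union>{C \<in> U // a. C \<subseteq> B}"
        using equiv_class_self[OF a xU] by (rule UnionI)
    qed auto
    then show "\<exists>S\<subseteq>U // a. B = \<Union>S"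
      by (intro exI[of _ "{C \<in> U // a. C \<subseteq> B}"]) auto
  qed
qed

lemma diagram_id_in_diagrams: "diagram_id n \<in> diagrams n"
  unfolding diagrams_def partitions_def diagram_id_def row0_def row1_def
  by (auto simp: equiv_def refl_on_def sym_def trans_def)

lemma stack_equiv:
  assumes "a \<in> diagrams n" "b \<in> diagrams n"
  shows "equiv (row0 n \<union> row1 n \<union> row2 n) (stack n a b)"
proof -
  have "a \<subseteq> (row0 n \<union> row1 n) \<times> (row0 n \<union> row1 n)" "b \<subseteq> (row0 n \<union> row1 n) \<times> (row0 n \<union> row1 n)"
    using assms by (auto simp: diagrams_def partitions_def equiv_def)
  moreover have "map_prod add_prime add_prime ` ((row0 n \<union> row1 n) \<times> (row0 n \<union> row1 n))
      \<subseteq> (row1 n \<union> row2 n) \<times> (row1 n \<union> row2 n)"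
    by (auto simp: row0_def row1_def row2_def)
  ultimately show ?thesis
    unfolding stack_def by (intro equiv_generated_equiv) blast
qed

text \<open>\<open>merge_primes\<close> identifies \<open>Primed i\<close> with
  \<open>DPrimed i\<close>, but the restriction has already removed the middle row, so the renaming
  is injective where it is applied.\<close>

lemma diagram_comp_in_diagrams:
  assumes "a \<in> diagrams n" "b \<in> diagrams n"
  shows "diagram_comp n a b \<in> diagrams n"
proof -
  have "inj_on merge_primes (row0 n \<union> row2 n)" "merge_primes ` (row0 n \<union> row2 n) = row0 n \<union> row1 n"
    by (auto simp: row0_def row1_def row2_def inj_on_def image_Un image_image)
  then show ?thesis
    using equiv_map_prod[OF equiv_restrict[OF stack_equiv[OF assms], of "row0 n \<union> row2 n"], of merge_primes]
    unfolding diagrams_def partitions_def diagram_comp_def by auto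
qed

text \<open>Renaming, generation, restriction and merging are each monotone on sets of
  pairs.\<close>

lemma diagram_comp_mono:
  assumes "a \<subseteq> a'" "b \<subseteq> b'"
  shows "diagram_comp n a b \<subseteq> diagram_comp n a' b'"
proof -
  have "stack n a b \<subseteq> stack n a' b'"
    unfolding stack_def using assms by (intro equiv_generated_mono) blast
  then show ?thesis
    unfolding diagram_comp_def by blast
qed

section \<open>Ramified tuples of diagrams\<close>

lemma ramified_iff:
  "a \<in> ramified n T r \<longleftrightarrow>
     a \<in> T \<rightarrow>\<^sub>E diagrams n \<and> (\<forall>t\<in>T. \<forall>t'\<in>T. (t, t') \<in> r \<longrightarrow> a t \<subseteq> a t')"
proof -
  have "refinement (row0 n \<union> row1 n) (a t) (a t') \<longleftrightarrow> a t \<subseteq> a t'"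
    if "a \<in> T \<rightarrow>\<^sub>E diagrams n" "t \<in> T" "t' \<in> T" for t t'
    using that by (intro refinement_iff_subset) (auto simp: diagrams_def partitions_def dest: PiE_mem)
  then show ?thesis
    by (cases "a \<in> T \<rightarrow>\<^sub>E diagrams n") (simp_all add: ramified_def)
qed

lemma ramified_diagram_comp:
  assumes "a \<in> ramified n T r" "b \<in> ramified n T r"
  shows "(\<lambda>t\<in>T. diagram_comp n (a t) (b t)) \<in> ramified n T r"
  unfolding ramified_iff
proof (intro conjI ballI impI)
  show "(\<lambda>t\<in>T. diagram_comp n (a t) (b t)) \<in> T \<rightarrow>\<^sub>E diagrams n"
    using assms by (auto simp: ramified_iff intro!: diagram_comp_in_diagrams dest: PiE_mem)
  fix t t' assume "t \<in> T" "t' \<in> T" "(t, t') \<in> r"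
  then show "(\<lambda>t\<in>T. diagram_comp n (a t) (b t)) t \<subseteq> (\<lambda>t\<in>T. diagram_comp n (a t) (b t)) t'"
    using assms by (simp add: ramified_iff diagram_comp_mono)
qed

text \<open>A constant tuple meets every inclusion condition. This tuple represents the unit of the
  tensor product.\<close>

lemma ramified_diagram_id: "(\<lambda>t\<in>T. diagram_id n) \<in> ramified n T r"
  unfolding ramified_iff by (auto simp: diagram_id_in_diagrams)

section \<open>Twisted algebras\<close>

lemma supp_basis_vec: "field K \<Longrightarrow> supp K (basis_vec K x) = {x}"
  by (auto simp: supp_def basis_vec_def domain.one_not_zero[OF field.axioms(1)])

text \<open>The locale is instantiated in two ways: by a partition algebra, with powers of its
  parameter as weights, and by the free module on tuples, with weight 1 and the componentwise
  product.\<close>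

locale twisted = field K for K (structure) +
  fixes X :: "'x set" and u :: 'x and m :: "'x \<Rightarrow> 'x \<Rightarrow> 'x" and w :: "'x \<Rightarrow> 'x \<Rightarrow> 'a"
  assumes unit_in: "u \<in> X"
    and m_in: "\<lbrakk>x \<in> X; y \<in> X\<rbrakk> \<Longrightarrow> m x y \<in> X"
    and w_in: "\<lbrakk>x \<in> X; y \<in> X\<rbrakk> \<Longrightarrow> w x y \<in> carrier K"
begin

abbreviation A where "A \<equiv> twisted_algebra K X u m w"

lemma in_carrier_iff:
  "f \<in> carrier A \<longleftrightarrow> (\<forall>x. f x \<in> carrier K) \<and> finite (supp K f) \<and> supp K f \<subseteq> X"
  unfolding twisted_algebra_def by auto

lemma A_simps:
  "f \<oplus>\<^bsub>A\<^esub> g = (\<lambda>x. f x \<oplus> g x)" "\<zero>\<^bsub>A\<^esub> = (\<lambda>_. \<zero>)" "c \<odot>\<^bsub>A\<^esub> f = (\<lambda>x. c \<otimes> f x)"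
  "\<one>\<^bsub>A\<^esub> = basis_vec K u"
  unfolding twisted_algebra_def by auto

lemma supp_bv [simp]: "supp K (basis_vec K x) = {x}"
  by (rule supp_basis_vec) (rule field_axioms)

lemma basis_vec_apply: "basis_vec K x y = (if y = x then \<one> else \<zero>)"
  by (simp add: basis_vec_def)

lemma basis_vec_in_carrier [simp]: "x \<in> X \<Longrightarrow> basis_vec K x \<in> carrier A"
  by (simp add: in_carrier_iff basis_vec_apply)

lemma not_in_supp: "x \<notin> supp K f \<Longrightarrow> f x = \<zero>"
  by (simp add: supp_def)

lemma supp_add: "supp K (\<lambda>x. f x \<oplus> g x) \<subseteq> supp K f \<union> supp K g"
  by (auto simp: supp_def)

lemma supp_smult: "c \<in> carrier K \<Longrightarrow> supp K (\<lambda>x. c \<otimes> f x) \<subseteq> supp K f"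
  by (auto simp: supp_def)

lemma module_A: "Module.module K A"
proof (rule module_criteria)
  show "cring K" by (rule is_cring)
  show "\<forall>f\<in>carrier A. \<exists>g\<in>carrier A. f \<oplus>\<^bsub>A\<^esub> g = \<zero>\<^bsub>A\<^esub>"
  proof
    fix f assume f: "f \<in> carrier A"
    have "supp K (\<lambda>x. \<ominus> f x) = supp K f"
      using f by (auto simp: supp_def in_carrier_iff)
    then have "(\<lambda>x. \<ominus> f x) \<in> carrier A"
      using f by (simp add: in_carrier_iff)
    moreover have "f \<oplus>\<^bsub>A\<^esub> (\<lambda>x. \<ominus> f x) = \<zero>\<^bsub>A\<^esub>"
      using f by (simp add: A_simps in_carrier_iff r_neg)
    ultimately show "\<exists>g\<in>carrier A. f \<oplus>\<^bsub>A\<^esub> g = \<zero>\<^bsub>A\<^esub>"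
      by blast
  qed
  show "\<forall>f g. f \<in> carrier A \<and> g \<in> carrier A \<longrightarrow> f \<oplus>\<^bsub>A\<^esub> g \<in> carrier A"
  proof (intro allI impI)
    fix f g assume fg: "f \<in> carrier A \<and> g \<in> carrier A"
    then have "finite (supp K f \<union> supp K g)" "supp K f \<union> supp K g \<subseteq> X"
      by (auto simp: in_carrier_iff)
    then show "f \<oplus>\<^bsub>A\<^esub> g \<in> carrier A"
      using fg finite_subset[OF supp_add[of f g]] subset_trans[OF supp_add[of f g]]
      by (simp add: in_carrier_iff A_simps)
  qed
  show "\<forall>c f. c \<in> carrier K \<and> f \<in> carrier A \<longrightarrow> c \<odot>\<^bsub>A\<^esub> f \<in> carrier A"
  proof (intro allI impI)
    fix c f assume cf: "c \<in> carrier K \<and> f \<in> carrier A"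
    then have "c \<in> carrier K" "finite (supp K f)" "supp K f \<subseteq> X"
      by (auto simp: in_carrier_iff)
    then show "c \<odot>\<^bsub>A\<^esub> f \<in> carrier A"
      using cf finite_subset[OF supp_smult[of c f]] subset_trans[OF supp_smult[of c f]]
      by (simp add: in_carrier_iff A_simps)
  qed
qed (auto simp: in_carrier_iff A_simps supp_def a_ac m_assoc l_distr r_distr)

text \<open>Supports vary with the arguments; over a common index set, linearity can be checked termwise.\<close>

lemma mult_eq_finsum:
  assumes f: "f \<in> carrier A" and g: "g \<in> carrier A"
    and S: "finite S" "supp K f \<subseteq> S" "S \<subseteq> X" and T: "finite T" "supp K g \<subseteq> T" "T \<subseteq> X"
  shows "(f \<otimes>\<^bsub>A\<^esub> g) z = (\<Oplus>x\<in>S. \<Oplus>y\<in>T. if m x y = z then f x \<otimes> g y \<otimes> w x y else \<zero>)"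
proof -
  let ?h = "\<lambda>x y. if m x y = z then f x \<otimes> g y \<otimes> w x y else \<zero>"
  have h: "?h x y \<in> carrier K" if "x \<in> S" "y \<in> T" for x y
    using that f g S T w_in[of x y] by (auto simp: in_carrier_iff subset_iff)
  \<comment> \<open>Outside the support of \<open>g\<close> every summand is zero, which shrinks the
    inner index set; \<open>outer\<close> then does the same for \<open>f\<close>.\<close>
  have inner: "(\<Oplus>y\<in>T. ?h x y) = (\<Oplus>y\<in>supp K g. ?h x y)" if "x \<in> S" for x
    using that f g S T h w_in[of x]
    by (intro add.finprod_mono_neutral_cong_right) (auto simp: in_carrier_iff not_in_supp subset_iff)
  have outer: "(\<Oplus>x\<in>S. \<Oplus>y\<in>T. ?h x y) = (\<Oplus>x\<in>supp K f. \<Oplus>y\<in>supp K g. ?h x y)"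
  proof (rule add.finprod_mono_neutral_cong_right)
    fix x assume x: "x \<in> S - supp K f"
    then have "?h x y = \<zero>" if "y \<in> T" for y
      using that f g S T w_in[of x y] by (auto simp: in_carrier_iff not_in_supp subset_iff)
    then show "(\<Oplus>y\<in>T. ?h x y) = \<zero>"
      by (intro add.finprod_one_eqI)
  qed (use S h inner in \<open>auto intro!: finsum_closed\<close>)
  show ?thesis
    unfolding outer by (simp add: twisted_algebra_def)
qed

lemma summand_in_carrier:
  assumes "f \<in> carrier A" "g \<in> carrier A" "T \<subseteq> X" "x \<in> X"
  shows "(\<lambda>y. if m x y = z then f x \<otimes> g y \<otimes> w x y else \<zero>) \<in> T \<rightarrow> carrier K"
  using assms w_in[of x] by (auto simp: in_carrier_iff subset_iff)

lemma inner_sum_in_carrier: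
  assumes "f \<in> carrier A" "g \<in> carrier A" "S \<subseteq> X" "T \<subseteq> X"
  shows "(\<lambda>x. \<Oplus>y\<in>T. if m x y = z then f x \<otimes> g y \<otimes> w x y else \<zero>) \<in> S \<rightarrow> carrier K"
  using assms by (intro funcsetI finsum_closed summand_in_carrier) auto

lemma mult_in_carrier:
  assumes f: "f \<in> carrier A" and g: "g \<in> carrier A"
  shows "f \<otimes>\<^bsub>A\<^esub> g \<in> carrier A"
proof -
  have fg: "finite (supp K f)" "supp K f \<subseteq> X" "finite (supp K g)" "supp K g \<subseteq> X"
    using f g by (auto simp: in_carrier_iff)
  note eq = mult_eq_finsum[OF f g fg(1) subset_refl fg(2) fg(3) subset_refl fg(4)]
  \<comment> \<open>At a point that is not \<open>m x y\<close> for x and y in the two supports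
    every summand is zero. Hence the support of the product is finite and inside
    \<open>X\<close>.\<close>
  have "supp K (f \<otimes>\<^bsub>A\<^esub> g) \<subseteq> (\<lambda>(x, y). m x y) ` (supp K f \<times> supp K g)"
  proof (rule subsetI, rule ccontr)
    fix z assume z: "z \<in> supp K (f \<otimes>\<^bsub>A\<^esub> g)" and nz: "z \<notin> (\<lambda>(x, y). m x y) ` (supp K f \<times> supp K g)"
    have "(f \<otimes>\<^bsub>A\<^esub> g) z = \<zero>"
      unfolding eq by (intro add.finprod_one_eqI) (use nz in auto)
    then show False
      using z by (simp add: supp_def)
  qed
  moreover have "(\<lambda>(x, y). m x y) ` (supp K f \<times> supp K g) \<subseteq> X"
    using fg m_in by auto
  ultimately have "finite (supp K (f \<otimes>\<^bsub>A\<^esub> g))" "supp K (f \<otimes>\<^bsub>A\<^esub> g) \<subseteq> X"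
    using fg by (auto intro: finite_subset)
  moreover have "(f \<otimes>\<^bsub>A\<^esub> g) z \<in> carrier K" for z
    unfolding eq by (intro finsum_closed inner_sum_in_carrier f g fg)
  ultimately show ?thesis
    by (simp add: in_carrier_iff)
qed

lemma bilinear: "bilinear_algebra K A"
proof -
  interpret M: Module.module K A by (rule module_A)
  show ?thesis
  proof
    show "\<one>\<^bsub>A\<^esub> \<in> carrier A"
      using unit_in by (simp add: A_simps(4))
    fix f g assume fg: "f \<in> carrier A" "g \<in> carrier A"
    then show "f \<otimes>\<^bsub>A\<^esub> g \<in> carrier A"
      by (rule mult_in_carrier)
    have fin: "finite (supp K f)" "supp K f \<subseteq> X" "finite (supp K g)" "supp K g \<subseteq> X"
      using fg by (auto simp: in_carrier_iff)
    {
      fix h assume h: "h \<in> carrier A"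
      then have finh: "finite (supp K h)" "supp K h \<subseteq> X"
        by (auto simp: in_carrier_iff)
      \<comment> \<open>Cancellation can make the support of a sum smaller than either support; the
        union is an index set that serves \<open>f\<close>, \<open>g\<close> and their sum
        alike.\<close>
      define S where "S = supp K f \<union> supp K g"
      have S: "finite S" "S \<subseteq> X" "supp K f \<subseteq> S" "supp K g \<subseteq> S" "supp K (f \<oplus>\<^bsub>A\<^esub> g) \<subseteq> S"
        using fin supp_add[of f g] by (auto simp: S_def A_simps)
      have K: "f x \<in> carrier K" "g x \<in> carrier K" "h x \<in> carrier K" for x
        using fg h by (auto simp: in_carrier_iff)
      note car = summand_in_carrier inner_sum_in_carrier
      show "(f \<oplus>\<^bsub>A\<^esub> g) \<otimes>\<^bsub>A\<^esub> h = f \<otimes>\<^bsub>A\<^esub> h \<oplus>\<^bsub>A\<^esub> g \<otimes>\<^bsub>A\<^esub> h"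
      proof
        fix z
        let ?t = "\<lambda>f h x y. if m x y = z then f x \<otimes> h y \<otimes> w x y else \<zero>"
        have "(f \<otimes>\<^bsub>A\<^esub> h \<oplus>\<^bsub>A\<^esub> g \<otimes>\<^bsub>A\<^esub> h) z =
            (\<Oplus>x\<in>S. \<Oplus>y\<in>supp K h. ?t f h x y) \<oplus> (\<Oplus>x\<in>S. \<Oplus>y\<in>supp K h. ?t g h x y)"
          using fg h S finh by (simp add: A_simps(1) mult_eq_finsum[where S = S and T = "supp K h"])
        also have "\<dots> = (\<Oplus>x\<in>S. (\<Oplus>y\<in>supp K h. ?t f h x y) \<oplus> (\<Oplus>y\<in>supp K h. ?t g h x y))"
          using fg h S finh by (intro finsum_addf[symmetric] car) auto
        also have "\<dots> = (\<Oplus>x\<in>S. \<Oplus>y\<in>supp K h. ?t (f \<oplus>\<^bsub>A\<^esub> g) h x y)"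
        proof (rule finsum_cong')
          fix x assume x: "x \<in> S"
          have "(\<Oplus>y\<in>supp K h. ?t f h x y) \<oplus> (\<Oplus>y\<in>supp K h. ?t g h x y)
              = (\<Oplus>y\<in>supp K h. ?t f h x y \<oplus> ?t g h x y)"
            using fg h S finh x by (intro finsum_addf[symmetric] car) auto
          also have "\<dots> = (\<Oplus>y\<in>supp K h. ?t (f \<oplus>\<^bsub>A\<^esub> g) h x y)"
            using fg h S finh x K w_in[of x]
            by (intro finsum_cong') (auto simp: A_simps(1) l_distr subset_iff)
          finally show "(\<Oplus>y\<in>supp K h. ?t f h x y) \<oplus> (\<Oplus>y\<in>supp K h. ?t g h x y) =
            (\<Oplus>y\<in>supp K h. ?t (f \<oplus>\<^bsub>A\<^esub> g) h x y)" .
        qed (use fg h S finh in \<open>intro refl car M.M.a_closed\<close>)+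
        also have "\<dots> = ((f \<oplus>\<^bsub>A\<^esub> g) \<otimes>\<^bsub>A\<^esub> h) z"
          using fg h S finh by (intro mult_eq_finsum[symmetric]) auto
        finally show "((f \<oplus>\<^bsub>A\<^esub> g) \<otimes>\<^bsub>A\<^esub> h) z = (f \<otimes>\<^bsub>A\<^esub> h \<oplus>\<^bsub>A\<^esub> g \<otimes>\<^bsub>A\<^esub> h) z" ..
      qed
      show "h \<otimes>\<^bsub>A\<^esub> (f \<oplus>\<^bsub>A\<^esub> g) = h \<otimes>\<^bsub>A\<^esub> f \<oplus>\<^bsub>A\<^esub> h \<otimes>\<^bsub>A\<^esub> g"
      proof
        fix z
        let ?t = "\<lambda>f h x y. if m x y = z then f x \<otimes> h y \<otimes> w x y else \<zero>"
        have "(h \<otimes>\<^bsub>A\<^esub> f \<oplus>\<^bsub>A\<^esub> h \<otimes>\<^bsub>A\<^esub> g) z =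
            (\<Oplus>x\<in>supp K h. \<Oplus>y\<in>S. ?t h f x y) \<oplus> (\<Oplus>x\<in>supp K h. \<Oplus>y\<in>S. ?t h g x y)"
          using fg h S finh by (simp add: A_simps(1) mult_eq_finsum[where T = S and S = "supp K h"])
        also have "\<dots> = (\<Oplus>x\<in>supp K h. (\<Oplus>y\<in>S. ?t h f x y) \<oplus> (\<Oplus>y\<in>S. ?t h g x y))"
          using fg h S finh by (intro finsum_addf[symmetric] car) auto
        also have "\<dots> = (\<Oplus>x\<in>supp K h. \<Oplus>y\<in>S. ?t h (f \<oplus>\<^bsub>A\<^esub> g) x y)"
        proof (rule finsum_cong')
          fix x assume x: "x \<in> supp K h"
          have "(\<Oplus>y\<in>S. ?t h f x y) \<oplus> (\<Oplus>y\<in>S. ?t h g x y)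
              = (\<Oplus>y\<in>S. ?t h f x y \<oplus> ?t h g x y)"
            using fg h S finh x by (intro finsum_addf[symmetric] car) auto
          also have "\<dots> = (\<Oplus>y\<in>S. ?t h (f \<oplus>\<^bsub>A\<^esub> g) x y)"
            using fg h S finh x K w_in[of x]
            by (intro finsum_cong') (auto simp: A_simps(1) l_distr r_distr subset_iff)
          finally show "(\<Oplus>y\<in>S. ?t h f x y) \<oplus> (\<Oplus>y\<in>S. ?t h g x y) =
            (\<Oplus>y\<in>S. ?t h (f \<oplus>\<^bsub>A\<^esub> g) x y)" .
        qed (use fg h S finh in \<open>intro refl car M.M.a_closed\<close>)+
        also have "\<dots> = (h \<otimes>\<^bsub>A\<^esub> (f \<oplus>\<^bsub>A\<^esub> g)) z"
          using fg h S finh by (intro mult_eq_finsum[symmetric]) auto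
        finally show "(h \<otimes>\<^bsub>A\<^esub> (f \<oplus>\<^bsub>A\<^esub> g)) z = (h \<otimes>\<^bsub>A\<^esub> f \<oplus>\<^bsub>A\<^esub> h \<otimes>\<^bsub>A\<^esub> g) z" ..
      qed
    }
    fix c assume c: "c \<in> carrier K"
    have K: "f x \<in> carrier K" "g x \<in> carrier K" for x
      using fg by (auto simp: in_carrier_iff)
    let ?t = "\<lambda>z f g x y. if m x y = z then f x \<otimes> g y \<otimes> w x y else \<zero>"
    note car = summand_in_carrier[OF fg fin(4)] inner_sum_in_carrier[OF fg fin(2) fin(4)]
    \<comment> \<open>Both scalar laws below are compared with this form, in which \<open>c\<close>
      has been moved inside the double sum.\<close>
    have pull: "(c \<odot>\<^bsub>A\<^esub> (f \<otimes>\<^bsub>A\<^esub> g)) z = (\<Oplus>x\<in>supp K f. \<Oplus>y\<in>supp K g. c \<otimes> ?t z f g x y)" for z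
    proof -
      have "(c \<odot>\<^bsub>A\<^esub> (f \<otimes>\<^bsub>A\<^esub> g)) z = c \<otimes> (\<Oplus>x\<in>supp K f. \<Oplus>y\<in>supp K g. ?t z f g x y)"
        using fg fin by (simp add: A_simps(3) mult_eq_finsum[where S = "supp K f" and T = "supp K g"])
      also have "\<dots> = (\<Oplus>x\<in>supp K f. c \<otimes> (\<Oplus>y\<in>supp K g. ?t z f g x y))"
        by (intro finsum_rdistr fin c car)
      also have "\<dots> = (\<Oplus>x\<in>supp K f. \<Oplus>y\<in>supp K g. c \<otimes> ?t z f g x y)"
        using c fin K w_in by (intro finsum_cong' refl finsum_rdistr funcsetI finsum_closed)
          (auto simp: subset_iff)
      finally show ?thesis .
    qed
    show "(c \<odot>\<^bsub>A\<^esub> f) \<otimes>\<^bsub>A\<^esub> g = c \<odot>\<^bsub>A\<^esub> (f \<otimes>\<^bsub>A\<^esub> g)"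
    proof
      fix z
      \<comment> \<open>For \<open>c\<close> = 0 the scaled vector has empty support, so the sum is
        taken over the support of \<open>f\<close>.\<close>
      have "((c \<odot>\<^bsub>A\<^esub> f) \<otimes>\<^bsub>A\<^esub> g) z = (\<Oplus>x\<in>supp K f. \<Oplus>y\<in>supp K g. ?t z (c \<odot>\<^bsub>A\<^esub> f) g x y)"
        using fg c fin supp_smult[OF c, of f, folded A_simps(3)] by (intro mult_eq_finsum M.smult_closed) auto
      also have "\<dots> = (\<Oplus>x\<in>supp K f. \<Oplus>y\<in>supp K g. c \<otimes> ?t z f g x y)"
        using c fin w_in K by (intro finsum_cong' refl funcsetI finsum_closed)
          (auto simp: A_simps m_assoc subset_iff)
      finally show "((c \<odot>\<^bsub>A\<^esub> f) \<otimes>\<^bsub>A\<^esub> g) z = (c \<odot>\<^bsub>A\<^esub> (f \<otimes>\<^bsub>A\<^esub> g)) z"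
        unfolding pull .
    qed
    show "f \<otimes>\<^bsub>A\<^esub> (c \<odot>\<^bsub>A\<^esub> g) = c \<odot>\<^bsub>A\<^esub> (f \<otimes>\<^bsub>A\<^esub> g)"
    proof
      fix z
      have "(f \<otimes>\<^bsub>A\<^esub> (c \<odot>\<^bsub>A\<^esub> g)) z = (\<Oplus>x\<in>supp K f. \<Oplus>y\<in>supp K g. ?t z f (c \<odot>\<^bsub>A\<^esub> g) x y)"
        using fg c fin supp_smult[OF c, of g, folded A_simps(3)] by (intro mult_eq_finsum M.smult_closed) auto
      also have "\<dots> = (\<Oplus>x\<in>supp K f. \<Oplus>y\<in>supp K g. c \<otimes> ?t z f g x y)"
        using c fin w_in K by (intro finsum_cong' refl funcsetI finsum_closed)
          (auto simp: A_simps m_ac subset_iff)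
      finally show "(f \<otimes>\<^bsub>A\<^esub> (c \<odot>\<^bsub>A\<^esub> g)) z = (c \<odot>\<^bsub>A\<^esub> (f \<otimes>\<^bsub>A\<^esub> g)) z"
        unfolding pull .
    qed
  qed
qed

lemma mult_basis_vec:
  assumes "x \<in> X" "y \<in> X"
  shows "basis_vec K x \<otimes>\<^bsub>A\<^esub> basis_vec K y = w x y \<odot>\<^bsub>A\<^esub> basis_vec K (m x y)"
  using assms w_in[of x y] by (auto simp: twisted_algebra_def basis_vec_apply fun_eq_iff Pi_def)

text \<open>Induction on the support: erasing one coordinate of a vector and adding back the
  matching multiple of a basis vector restores it. The lemma acts as an induction principle for
  properties that are stable under linear combinations.\<close>

lemma carrier_subset_submodule:
  assumes N: "submodule K N A" and bv: "\<And>x. x \<in> X \<Longrightarrow> basis_vec K x \<in> N"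
  shows "carrier A \<subseteq> N"
proof
  interpret N: submodule K N A by fact
  have "\<forall>f. f \<in> carrier A \<and> supp K f = S \<longrightarrow> f \<in> N" if "finite S" for S
    using that
  proof induction
    case empty
    have "f \<in> N" if "supp K f = {}" for f
    proof -
      have "f = \<zero>\<^bsub>A\<^esub>"
        using that by (auto simp: supp_def A_simps)
      then show ?thesis
        using N.zero_closed by simp
    qed
    then show ?case
      by blast
  next
    case (insert x S)
    show ?case
    proof clarify
      fix f assume f: "f \<in> carrier A" "supp K f = insert x S"
      have "supp K (f(x := \<zero>)) = S"
        using f insert.hyps by (auto simp: supp_def split: if_splits)
      then have "f(x := \<zero>) \<in> N"
        using f insert by (auto simp: in_carrier_iff)
      moreover have "f x \<odot>\<^bsub>A\<^esub> basis_vec K x \<in> N"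
        using f bv by (auto simp: in_carrier_iff)
      moreover have "f = f(x := \<zero>) \<oplus>\<^bsub>A\<^esub> f x \<odot>\<^bsub>A\<^esub> basis_vec K x"
        using f by (auto simp: A_simps basis_vec_def in_carrier_iff fun_eq_iff)
      ultimately show "f \<in> N"
        using N.m_closed by metis
    qed
  qed
  then show "f \<in> N" if "f \<in> carrier A" for f
    using that by (auto simp: in_carrier_iff)
qed

section \<open>Linear functionals with prescribed values on the basis vectors\<close>

definition linear_extension :: "('x \<Rightarrow> 'a) \<Rightarrow> ('x \<Rightarrow> 'a) \<Rightarrow> 'a" where
  "linear_extension h f = (\<Oplus>x\<in>supp K f. f x \<otimes> h x)"

context
  fixes h assumes h: "h \<in> X \<rightarrow> carrier K"
begin

lemma linear_extension_eq_finsum: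
  assumes f: "f \<in> carrier A" and S: "finite S" "supp K f \<subseteq> S" "S \<subseteq> X"
  shows "linear_extension h f = (\<Oplus>x\<in>S. f x \<otimes> h x)"
  unfolding linear_extension_def using assms h
  by (intro add.finprod_mono_neutral_cong_left)
    (auto simp: in_carrier_iff not_in_supp Pi_def subset_iff)

lemma linear_extension_add:
  assumes f: "f \<in> carrier A" and g: "g \<in> carrier A"
  shows "linear_extension h (f \<oplus>\<^bsub>A\<^esub> g) = linear_extension h f \<oplus> linear_extension h g"
proof -
  interpret M: Module.module K A by (rule module_A)
  define S where "S = supp K f \<union> supp K g"
  have S: "finite S" "S \<subseteq> X" "supp K f \<subseteq> S" "supp K g \<subseteq> S" "supp K (f \<oplus>\<^bsub>A\<^esub> g) \<subseteq> S"
    using f g supp_add[of f g] by (auto simp: S_def A_simps in_carrier_iff)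
  have K: "f x \<in> carrier K" "g x \<in> carrier K" "x \<in> S \<Longrightarrow> h x \<in> carrier K" for x
    using f g h S by (auto simp: in_carrier_iff)
  have "linear_extension h (f \<oplus>\<^bsub>A\<^esub> g) = (\<Oplus>x\<in>S. (f \<oplus>\<^bsub>A\<^esub> g) x \<otimes> h x)"
    using f g S by (intro linear_extension_eq_finsum M.M.a_closed)
  also have "\<dots> = (\<Oplus>x\<in>S. f x \<otimes> h x \<oplus> g x \<otimes> h x)"
    using K by (intro finsum_cong') (auto simp: A_simps(1) l_distr)
  also have "\<dots> = (\<Oplus>x\<in>S. f x \<otimes> h x) \<oplus> (\<Oplus>x\<in>S. g x \<otimes> h x)"
    using K by (intro finsum_addf) auto
  also have "\<dots> = linear_extension h f \<oplus> linear_extension h g"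
    using f g S by (simp add: linear_extension_eq_finsum[where S = S])
  finally show ?thesis .
qed

lemma linear_extension_smult:
  assumes c: "c \<in> carrier K" and f: "f \<in> carrier A"
  shows "linear_extension h (c \<odot>\<^bsub>A\<^esub> f) = c \<otimes> linear_extension h f"
proof -
  interpret M: Module.module K A by (rule module_A)
  have S: "finite (supp K f)" "supp K f \<subseteq> X" "supp K (c \<odot>\<^bsub>A\<^esub> f) \<subseteq> supp K f"
    using c f supp_smult[of c f] by (auto simp: A_simps in_carrier_iff)
  have K: "f x \<in> carrier K" "x \<in> supp K f \<Longrightarrow> h x \<in> carrier K" for x
    using f h S by (auto simp: in_carrier_iff)
  have "linear_extension h (c \<odot>\<^bsub>A\<^esub> f) = (\<Oplus>x\<in>supp K f. (c \<odot>\<^bsub>A\<^esub> f) x \<otimes> h x)"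
    using c f S by (intro linear_extension_eq_finsum M.smult_closed)
  also have "\<dots> = (\<Oplus>x\<in>supp K f. c \<otimes> (f x \<otimes> h x))"
    using c K by (intro finsum_cong') (auto simp: A_simps(3) m_assoc)
  also have "\<dots> = c \<otimes> linear_extension h f"
    unfolding linear_extension_def using c S K by (intro finsum_rdistr[symmetric]) auto
  finally show ?thesis .
qed

lemma linear_extension_basis_vec:
  "x \<in> X \<Longrightarrow> linear_extension h (basis_vec K x) = h x"
  using h by (auto simp: linear_extension_def basis_vec_apply Pi_def)

lemma linear_extension_minus:
  assumes f: "f \<in> carrier A" and g: "g \<in> carrier A"
  shows "linear_extension h (f \<ominus>\<^bsub>A\<^esub> g) = linear_extension h f \<ominus> linear_extension h g"
proof -
  have "linear_extension h g \<in> carrier K"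
    unfolding linear_extension_def using g h by (intro finsum_closed) (auto simp: in_carrier_iff)
  note * = this
  interpret bilinear_algebra K A by (rule bilinear)
  show ?thesis
    using f g * by (simp add: M.minus_eq linear_extension_add linear_extension_smult l_minus a_minus_def
      flip: smult_neg_one)
qed

text \<open>The separating submodules of a tensor product are images of kernels of this
  kind.\<close>

lemma kernel_submodule: "submodule K {f \<in> carrier A. linear_extension h f = \<zero>} A"
proof -
  interpret M: Module.module K A by (rule module_A)
  show ?thesis
  proof
    have "supp K \<zero>\<^bsub>A\<^esub> = {}"
      by (simp add: supp_def A_simps)
    then show "\<zero>\<^bsub>A\<^esub> \<in> {f \<in> carrier A. linear_extension h f = \<zero>}"
      by (simp add: linear_extension_def)
  qed (auto simp: M.module_axioms linear_extension_add linear_extension_smult)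
qed

end

end

section \<open>Quotients by two-sided ideals\<close>

text \<open>This is the construction of \<open>tensor_algebra\<close> with an arbitrary algebra and
  subset in place of the tuple algebra and \<open>tensor_kernel\<close>, so that cosets can be
  studied without reference to tuples.\<close>

definition quotient_algebra ::
  "('k, 'a, 'n) module_scheme \<Rightarrow> 'a set \<Rightarrow> ('k, 'a set) module" where
  "quotient_algebra A N = ring.extend (A Quot N)
     (module.fields (\<lambda>c S. \<Union>f\<in>S. N +>\<^bsub>A\<^esub> (c \<odot>\<^bsub>A\<^esub> f)))"

locale bilinear_ideal = bilinear_algebra K A for N and K (structure) and A (structure) +
  assumes sub: "submodule K N A"
    and ideal_l: "\<lbrakk>x \<in> carrier A; y \<in> N\<rbrakk> \<Longrightarrow> x \<otimes>\<^bsub>A\<^esub> y \<in> N"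
    and ideal_r: "\<lbrakk>x \<in> carrier A; y \<in> N\<rbrakk> \<Longrightarrow> y \<otimes>\<^bsub>A\<^esub> x \<in> N"
begin

sublocale N: abelian_subgroup N A
  using sub by (rule submodule_abelian_subgroup)

abbreviation W where "W \<equiv> quotient_algebra A N"

lemma quotient_simps:
  "carrier W = (\<lambda>x. N +>\<^bsub>A\<^esub> x) ` carrier A" "\<zero>\<^bsub>W\<^esub> = N" "\<one>\<^bsub>W\<^esub> = N +>\<^bsub>A\<^esub> \<one>\<^bsub>A\<^esub>"
  "X \<oplus>\<^bsub>W\<^esub> Y = X <+>\<^bsub>A\<^esub> Y" "X \<otimes>\<^bsub>W\<^esub> Y = rcoset_mult A N X Y"
  "c \<odot>\<^bsub>W\<^esub> X = (\<Union>f\<in>X. N +>\<^bsub>A\<^esub> (c \<odot>\<^bsub>A\<^esub> f))"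
  by (auto simp: quotient_algebra_def ring.extend_def module.fields_def FactRing_def
      A_RCOSETS_def' a_r_coset_def')

lemma mem_coset_iff: "x \<in> carrier A \<Longrightarrow> y \<in> N +>\<^bsub>A\<^esub> x \<longleftrightarrow> y \<in> carrier A \<and> y \<ominus>\<^bsub>A\<^esub> x \<in> N"
  using N.a_rcos_module[of x y] N.a_elemrcos_carrier[of x y] by (auto simp: M.minus_eq)

lemma coset_self: "x \<in> carrier A \<Longrightarrow> x \<in> N +>\<^bsub>A\<^esub> x"
  by (simp add: mem_coset_iff M.minus_eq M.r_neg)

lemma coset_eq_iff:
  assumes "x \<in> carrier A" "y \<in> carrier A"
  shows "N +>\<^bsub>A\<^esub> x = N +>\<^bsub>A\<^esub> y \<longleftrightarrow> x \<ominus>\<^bsub>A\<^esub> y \<in> N"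
  using assms N.a_repr_independence'[of x y] coset_self mem_coset_iff by metis

lemma add_coset:
  assumes "x \<in> carrier A" "y \<in> carrier A"
  shows "(N +>\<^bsub>A\<^esub> x) \<oplus>\<^bsub>W\<^esub> (N +>\<^bsub>A\<^esub> y) = N +>\<^bsub>A\<^esub> (x \<oplus>\<^bsub>A\<^esub> y)"
  using assms by (simp add: quotient_simps N.a_rcos_sum)

lemma zero_coset: "\<zero>\<^bsub>W\<^esub> = N +>\<^bsub>A\<^esub> \<zero>\<^bsub>A\<^esub>"
  by (simp add: quotient_simps N.a_rcos_const)

text \<open>The action is a union over all representatives of the coset. They all contribute the
  same coset, because scaling keeps their differences in \<open>N\<close>.\<close>

lemma smult_coset:
  assumes c: "c \<in> carrier K" and x: "x \<in> carrier A"
  shows "c \<odot>\<^bsub>W\<^esub> (N +>\<^bsub>A\<^esub> x) = N +>\<^bsub>A\<^esub> (c \<odot>\<^bsub>A\<^esub> x)"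
proof -
  have "N +>\<^bsub>A\<^esub> (c \<odot>\<^bsub>A\<^esub> y) = N +>\<^bsub>A\<^esub> (c \<odot>\<^bsub>A\<^esub> x)" if y: "y \<in> N +>\<^bsub>A\<^esub> x" for y
  proof -
    have yA: "y \<in> carrier A" "y \<ominus>\<^bsub>A\<^esub> x \<in> N"
      using y x by (auto simp: mem_coset_iff)
    have "c \<odot>\<^bsub>A\<^esub> y \<ominus>\<^bsub>A\<^esub> c \<odot>\<^bsub>A\<^esub> x = c \<odot>\<^bsub>A\<^esub> (y \<ominus>\<^bsub>A\<^esub> x)"
      using c x yA by (simp add: M.minus_eq smult_r_distr smult_r_minus)
    also have "\<dots> \<in> N"
      using c yA submodule.smult_closed[OF sub] by simp
    finally show ?thesis
      using c x yA by (simp add: coset_eq_iff)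
  qed
  then show ?thesis
    unfolding quotient_simps using coset_self[OF x] by blast
qed

text \<open>The representatives are exchanged one at a time: ab - xb = (a - x)b is in
  \<open>N\<close> by the right ideal property and xb - xy = x(b - y) by the left one.\<close>

lemma mult_coset:
  assumes x: "x \<in> carrier A" and y: "y \<in> carrier A"
  shows "(N +>\<^bsub>A\<^esub> x) \<otimes>\<^bsub>W\<^esub> (N +>\<^bsub>A\<^esub> y) = N +>\<^bsub>A\<^esub> (x \<otimes>\<^bsub>A\<^esub> y)"
proof -
  have "N +>\<^bsub>A\<^esub> (a \<otimes>\<^bsub>A\<^esub> b) = N +>\<^bsub>A\<^esub> (x \<otimes>\<^bsub>A\<^esub> y)" if a: "a \<in> N +>\<^bsub>A\<^esub> x" and b: "b \<in> N +>\<^bsub>A\<^esub> y" for a b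
  proof -
    have ab: "a \<in> carrier A" "a \<ominus>\<^bsub>A\<^esub> x \<in> N" "b \<in> carrier A" "b \<ominus>\<^bsub>A\<^esub> y \<in> N"
      using a b x y by (auto simp: mem_coset_iff)
    have "(a \<ominus>\<^bsub>A\<^esub> x) \<otimes>\<^bsub>A\<^esub> b \<in> N" "x \<otimes>\<^bsub>A\<^esub> (b \<ominus>\<^bsub>A\<^esub> y) \<in> N"
      using ab x by (auto intro: ideal_l ideal_r)
    then have "a \<otimes>\<^bsub>A\<^esub> b \<ominus>\<^bsub>A\<^esub> x \<otimes>\<^bsub>A\<^esub> b \<in> N" "x \<otimes>\<^bsub>A\<^esub> b \<ominus>\<^bsub>A\<^esub> x \<otimes>\<^bsub>A\<^esub> y \<in> N"
      using ab x y by (simp_all add: mult_minus_l mult_minus_r)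
    then show ?thesis
      using ab x y by (metis coset_eq_iff mult_closed)
  qed
  then show ?thesis
    unfolding quotient_simps rcoset_mult_def using coset_self[OF x] coset_self[OF y] by blast
qed

lemmas coset_simps = add_coset smult_coset mult_coset zero_coset quotient_simps(3)

lemma bilinear_quotient: "bilinear_algebra K W"
proof -
  have W: "X \<in> carrier W \<longleftrightarrow> (\<exists>x\<in>carrier A. X = N +>\<^bsub>A\<^esub> x)" for X
    by (auto simp: quotient_simps)
  have "Module.module K W"
  proof (rule module_criteria)
    show "\<forall>v\<in>carrier W. \<exists>neg_v\<in>carrier W. v \<oplus>\<^bsub>W\<^esub> neg_v = \<zero>\<^bsub>W\<^esub>"
    proof
      fix v assume "v \<in> carrier W"
      then obtain x where x: "x \<in> carrier A" "v = N +>\<^bsub>A\<^esub> x"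
        unfolding W by blast
      then have "v \<oplus>\<^bsub>W\<^esub> (N +>\<^bsub>A\<^esub> (\<ominus>\<^bsub>A\<^esub> x)) = \<zero>\<^bsub>W\<^esub>"
        by (simp add: coset_simps M.r_neg)
      moreover have "N +>\<^bsub>A\<^esub> (\<ominus>\<^bsub>A\<^esub> x) \<in> carrier W"
        using x unfolding W by blast
      ultimately show "\<exists>neg_v\<in>carrier W. v \<oplus>\<^bsub>W\<^esub> neg_v = \<zero>\<^bsub>W\<^esub>"
        by blast
    qed
  qed (unfold Ball_def W, auto simp: R.is_cring coset_simps M.a_ac smult_assoc1 smult_l_distr smult_r_distr)
  then interpret Q: Module.module K W .
  show ?thesis
    by unfold_locales
      (unfold W, auto simp: coset_simps mult_l_distr mult_r_distr mult_smult_l mult_smult_r)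
qed

lemma submodule_image_coset:
  assumes "submodule K S A"
  shows "submodule K ((\<lambda>x. N +>\<^bsub>A\<^esub> x) ` S) W"
proof -
  interpret S: submodule K S A by fact
  interpret Q: bilinear_algebra K W by (rule bilinear_quotient)
  have SA: "x \<in> S \<Longrightarrow> x \<in> carrier A" for x
    using S.subset by blast
  show ?thesis
  proof (rule submodule.intro)
    show "Module.module K W" by (rule Q.module_axioms)
    show "(\<lambda>x. N +>\<^bsub>A\<^esub> x) ` S \<subseteq> carrier W"
      using SA by (auto simp: quotient_simps)
    show "\<zero>\<^bsub>W\<^esub> \<in> (\<lambda>x. N +>\<^bsub>A\<^esub> x) ` S"
      using S.zero_closed by (simp add: zero_coset)
  qed (auto simp: coset_simps SA)
qed

end

section \<open>Tensor products\<close>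

locale tensor_family = field K for K (structure) +
  fixes I :: "'i set" and F :: "'i \<Rightarrow> ('a, 'c, 'n) module_scheme"
  assumes finite_index: "finite I"
    and bilinear_factor: "i \<in> I \<Longrightarrow> bilinear_algebra K (F i)"
begin

abbreviation "tuples \<equiv> \<Pi>\<^sub>E i\<in>I. carrier (F i)"
abbreviation "TA \<equiv> tuple_algebra K I F"
abbreviation "relations \<equiv> multilinear_relations K I F"
abbreviation "ker \<equiv> tensor_kernel K I F"

definition tuple_mult :: "('i \<Rightarrow> 'c) \<Rightarrow> ('i \<Rightarrow> 'c) \<Rightarrow> 'i \<Rightarrow> 'c" where
  "tuple_mult x y = (\<lambda>i\<in>I. x i \<otimes>\<^bsub>F i\<^esub> y i)"

lemma mult_factor_closed:
  "i \<in> I \<Longrightarrow> x \<in> carrier (F i) \<Longrightarrow> y \<in> carrier (F i) \<Longrightarrow> x \<otimes>\<^bsub>F i\<^esub> y \<in> carrier (F i)"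
  using bilinear_factor by (rule bilinear_algebra.mult_closed)

lemma unit_factor_closed: "i \<in> I \<Longrightarrow> \<one>\<^bsub>F i\<^esub> \<in> carrier (F i)"
  using bilinear_factor by (rule bilinear_algebra.unit_closed)

lemma module_factor: "i \<in> I \<Longrightarrow> Module.module K (F i)"
  using bilinear_factor by (rule bilinear_algebra.axioms)

lemma smult_factor_closed:
  "i \<in> I \<Longrightarrow> c \<in> carrier K \<Longrightarrow> x \<in> carrier (F i) \<Longrightarrow> c \<odot>\<^bsub>F i\<^esub> x \<in> carrier (F i)"
  using module_factor by (rule Module.module.smult_closed)

lemma add_factor_closed:
  "i \<in> I \<Longrightarrow> x \<in> carrier (F i) \<Longrightarrow> y \<in> carrier (F i) \<Longrightarrow> x \<oplus>\<^bsub>F i\<^esub> y \<in> carrier (F i)"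
  using abelian_monoid.a_closed[OF abelian_group.axioms(1)[OF Module.module.axioms(2)[OF module_factor]]] .

lemma update_tuple: "x \<in> tuples \<Longrightarrow> i \<in> I \<Longrightarrow> u \<in> carrier (F i) \<Longrightarrow> x(i := u) \<in> tuples"
  by (auto simp: PiE_def extensional_def)

lemma mult_tuple: "x \<in> tuples \<Longrightarrow> y \<in> tuples \<Longrightarrow> tuple_mult x y \<in> tuples"
  unfolding tuple_mult_def by (auto intro: mult_factor_closed dest: PiE_mem)

sublocale T: twisted K tuples "\<lambda>i\<in>I. \<one>\<^bsub>F i\<^esub>" tuple_mult "\<lambda>_ _. \<one>"
  rewrites "twisted_algebra K tuples (\<lambda>i\<in>I. \<one>\<^bsub>F i\<^esub>) tuple_mult (\<lambda>_ _. \<one>) = TA"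
proof -
  show "twisted K tuples (\<lambda>i\<in>I. \<one>\<^bsub>F i\<^esub>) tuple_mult (\<lambda>_ _. \<one>)"
  proof (intro twisted.intro twisted_axioms.intro field_axioms)
    show "tuple_mult x y \<in> tuples" if "x \<in> tuples" "y \<in> tuples" for x y
      using that by (rule mult_tuple)
  qed (auto intro: unit_factor_closed)
qed (simp add: tuple_algebra_def tuple_mult_def[abs_def])

sublocale T: bilinear_algebra K TA
  by (rule T.bilinear)

lemma mult_tuple_basis_vec:
  assumes "x \<in> tuples" "y \<in> tuples"
  shows "basis_vec K x \<otimes>\<^bsub>TA\<^esub> basis_vec K y = basis_vec K (tuple_mult x y)"
  using T.mult_basis_vec[OF assms] mult_tuple[OF assms] by simp

section \<open>The multilinearity relations and the two-sided ideal they span\<close>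

lemma relation_add:
  assumes "x \<in> tuples" "i \<in> I" "u \<in> carrier (F i)" "v \<in> carrier (F i)"
  shows "basis_vec K (x(i := u \<oplus>\<^bsub>F i\<^esub> v))
    \<ominus>\<^bsub>TA\<^esub> (basis_vec K (x(i := u)) \<oplus>\<^bsub>TA\<^esub> basis_vec K (x(i := v))) \<in> relations"
  unfolding multilinear_relations_def using assms by blast

lemma relation_smult:
  assumes "x \<in> tuples" "i \<in> I" "c \<in> carrier K" "u \<in> carrier (F i)"
  shows "basis_vec K (x(i := c \<odot>\<^bsub>F i\<^esub> u)) \<ominus>\<^bsub>TA\<^esub> (c \<odot>\<^bsub>TA\<^esub> basis_vec K (x(i := u))) \<in> relations"
  unfolding multilinear_relations_def using assms by blast

lemma relation_cases:
  assumes "\<rho> \<in> relations"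
  obtains (add) x i u v where "x \<in> tuples" "i \<in> I" "u \<in> carrier (F i)" "v \<in> carrier (F i)"
      "\<rho> = basis_vec K (x(i := u \<oplus>\<^bsub>F i\<^esub> v))
        \<ominus>\<^bsub>TA\<^esub> (basis_vec K (x(i := u)) \<oplus>\<^bsub>TA\<^esub> basis_vec K (x(i := v)))"
  | (smult) x i c u where "x \<in> tuples" "i \<in> I" "c \<in> carrier K" "u \<in> carrier (F i)"
      "\<rho> = basis_vec K (x(i := c \<odot>\<^bsub>F i\<^esub> u)) \<ominus>\<^bsub>TA\<^esub> (c \<odot>\<^bsub>TA\<^esub> basis_vec K (x(i := u)))"
  using assms unfolding multilinear_relations_def by blast

lemma relations_in_carrier: "relations \<subseteq> carrier TA"
proof
  fix \<rho> assume "\<rho> \<in> relations"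
  then show "\<rho> \<in> carrier TA"
    by (cases rule: relation_cases)
      (simp_all add: update_tuple add_factor_closed smult_factor_closed)
qed

text \<open>A componentwise product feels a change of one coordinate in that coordinate alone; this
  preserves the shape of the relations.\<close>

lemma tuple_mult_update_l:
  "i \<in> I \<Longrightarrow> tuple_mult (x(i := u)) y = (tuple_mult x y)(i := u \<otimes>\<^bsub>F i\<^esub> y i)"
  by (auto simp: fun_eq_iff tuple_mult_def)

lemma tuple_mult_update_r:
  "i \<in> I \<Longrightarrow> tuple_mult x (y(i := u)) = (tuple_mult x y)(i := x i \<otimes>\<^bsub>F i\<^esub> u)"
  by (auto simp: fun_eq_iff tuple_mult_def)

text \<open>The product in coordinate \<open>i\<close> is bilinear, so multiplying a relation at the
  tuple \<open>x\<close> by \<open>y\<close> gives the relation of the same kind at the product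
  tuple, with \<open>u\<close> and \<open>v\<close> multiplied by \<open>y i\<close>.\<close>

lemma relations_mult_basis_vec:
  assumes "\<rho> \<in> relations" and y: "y \<in> tuples"
  shows "basis_vec K y \<otimes>\<^bsub>TA\<^esub> \<rho> \<in> relations" and "\<rho> \<otimes>\<^bsub>TA\<^esub> basis_vec K y \<in> relations"
proof -
  note [simp] = update_tuple add_factor_closed smult_factor_closed mult_tuple_basis_vec
    T.mult_minus_l T.mult_minus_r T.mult_l_distr T.mult_r_distr T.mult_smult_l T.mult_smult_r y
  have yi: "i \<in> I \<Longrightarrow> y i \<in> carrier (F i)" for i
    using PiE_mem[OF y] by simp
  have "basis_vec K y \<otimes>\<^bsub>TA\<^esub> \<rho> \<in> relations \<and> \<rho> \<otimes>\<^bsub>TA\<^esub> basis_vec K y \<in> relations"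
    using assms(1)
  proof (cases rule: relation_cases)
    case (add x i u v)
    interpret Fi: bilinear_algebra K "F i" using add(2) by (rule bilinear_factor)
    show ?thesis
      using relation_add[of "tuple_mult y x" i "y i \<otimes>\<^bsub>F i\<^esub> u" "y i \<otimes>\<^bsub>F i\<^esub> v"]
        relation_add[of "tuple_mult x y" i "u \<otimes>\<^bsub>F i\<^esub> y i" "v \<otimes>\<^bsub>F i\<^esub> y i"] add yi[of i] y
      by (simp add: mult_tuple tuple_mult_update_l tuple_mult_update_r Fi.mult_l_distr Fi.mult_r_distr)
  next
    case (smult x i c u)
    interpret Fi: bilinear_algebra K "F i" using smult(2) by (rule bilinear_factor)
    show ?thesis
      using relation_smult[of "tuple_mult y x" i c "y i \<otimes>\<^bsub>F i\<^esub> u"]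
        relation_smult[of "tuple_mult x y" i c "u \<otimes>\<^bsub>F i\<^esub> y i"] smult yi[of i] y
      by (simp add: mult_tuple tuple_mult_update_l tuple_mult_update_r Fi.mult_smult_l Fi.mult_smult_r)
  qed
  then show "basis_vec K y \<otimes>\<^bsub>TA\<^esub> \<rho> \<in> relations" "\<rho> \<otimes>\<^bsub>TA\<^esub> basis_vec K y \<in> relations"
    by blast+
qed

lemma kernel_submodule: "submodule K ker TA"
  unfolding tensor_kernel_def using relations_in_carrier by (rule T.span_is_submodule)

lemma relations_subset_kernel: "relations \<subseteq> ker"
  unfolding tensor_kernel_def using relations_in_carrier by (rule T.in_own_span)

lemma kernel_subset_submodule: "submodule K S TA \<Longrightarrow> relations \<subseteq> S \<Longrightarrow> ker \<subseteq> S"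
  unfolding tensor_kernel_def by (intro T.span_is_subset)

text \<open>Two span arguments: for a fixed relation, the good factors form a submodule that
  contains all basis vectors; for a fixed \<open>f\<close>, the good \<open>g\<close> form a
  submodule that contains all relations.\<close>

lemma kernel_ideal:
  assumes f: "f \<in> carrier TA" and g: "g \<in> ker"
  shows "f \<otimes>\<^bsub>TA\<^esub> g \<in> ker" "g \<otimes>\<^bsub>TA\<^esub> f \<in> ker"
proof -
  interpret N: submodule K ker TA by (rule kernel_submodule)
  have zero: "f \<otimes>\<^bsub>TA\<^esub> \<zero>\<^bsub>TA\<^esub> = \<zero>\<^bsub>TA\<^esub>" "\<zero>\<^bsub>TA\<^esub> \<otimes>\<^bsub>TA\<^esub> f = \<zero>\<^bsub>TA\<^esub>" if "f \<in> carrier TA" for f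
    using T.mult_smult_r[of \<zero> f "\<zero>\<^bsub>TA\<^esub>"] T.mult_smult_l[of \<zero> "\<zero>\<^bsub>TA\<^esub>" f] that by auto
  have rel: "f \<otimes>\<^bsub>TA\<^esub> \<rho> \<in> ker \<and> \<rho> \<otimes>\<^bsub>TA\<^esub> f \<in> ker"
    if f: "f \<in> carrier TA" and \<rho>: "\<rho> \<in> relations" for f \<rho>
  proof -
    let ?S = "{f \<in> carrier TA. f \<otimes>\<^bsub>TA\<^esub> \<rho> \<in> ker \<and> \<rho> \<otimes>\<^bsub>TA\<^esub> f \<in> ker}"
    have \<rho>A: "\<rho> \<in> carrier TA"
      using \<rho> relations_in_carrier by blast
    have "submodule K ?S TA"
      by unfold_locales
        (use \<rho>A in \<open>auto simp: zero T.mult_l_distr T.mult_r_distr T.mult_smult_l T.mult_smult_r\<close>)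
    moreover have "basis_vec K x \<in> ?S" if "x \<in> tuples" for x
      using that relations_mult_basis_vec[OF \<rho> that] relations_subset_kernel by auto
    ultimately have "carrier TA \<subseteq> ?S"
      by (rule T.carrier_subset_submodule)
    then show ?thesis
      using f by blast
  qed
  let ?S = "{g \<in> carrier TA. f \<otimes>\<^bsub>TA\<^esub> g \<in> ker \<and> g \<otimes>\<^bsub>TA\<^esub> f \<in> ker}"
  have "submodule K ?S TA"
    by unfold_locales
      (use f in \<open>auto simp: zero T.mult_l_distr T.mult_r_distr T.mult_smult_l T.mult_smult_r\<close>)
  moreover have "relations \<subseteq> ?S"
    using rel[OF f] relations_in_carrier by blast
  ultimately have "ker \<subseteq> ?S"
    by (rule kernel_subset_submodule)
  then show "f \<otimes>\<^bsub>TA\<^esub> g \<in> ker" "g \<otimes>\<^bsub>TA\<^esub> f \<in> ker"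
    using g by blast+
qed

sublocale T: bilinear_ideal ker K TA
  rewrites "quotient_algebra TA ker = tensor_algebra K I F"
proof -
  show "bilinear_ideal ker K TA"
    by (intro bilinear_ideal.intro bilinear_ideal_axioms.intro T.bilinear_algebra_axioms
        kernel_submodule kernel_ideal)
qed (simp add: quotient_algebra_def tensor_algebra_def)

section \<open>Pure tensors and functionals that test them\<close>

abbreviation "pure \<equiv> pure_tensor K I F"

lemma pure_in_carrier: "x \<in> tuples \<Longrightarrow> pure x \<in> carrier (tensor_algebra K I F)"
  by (simp add: pure_tensor_def T.quotient_simps)

lemma pure_mult:
  assumes "x \<in> tuples" "y \<in> tuples"
  shows "pure x \<otimes>\<^bsub>tensor_algebra K I F\<^esub> pure y = pure (tuple_mult x y)"
  using assms by (simp add: pure_tensor_def T.mult_coset mult_tuple_basis_vec)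

lemma one_eq_pure: "\<one>\<^bsub>tensor_algebra K I F\<^esub> = pure (\<lambda>i\<in>I. \<one>\<^bsub>F i\<^esub>)"
  by (simp add: T.quotient_simps pure_tensor_def T.A_simps)

lemma pure_update_smult:
  assumes "x \<in> tuples" "i \<in> I" "c \<in> carrier K"
  shows "pure (x(i := c \<odot>\<^bsub>F i\<^esub> x i)) = c \<odot>\<^bsub>tensor_algebra K I F\<^esub> pure x"
proof -
  have xi: "x i \<in> carrier (F i)"
    using assms by (auto dest: PiE_mem)
  \<comment> \<open>This is the scalar relation with \<open>u\<close> = \<open>x i\<close>, where
    \<open>x(i := x i)\<close> is \<open>x\<close> itself.\<close>
  have "basis_vec K (x(i := c \<odot>\<^bsub>F i\<^esub> x i)) \<ominus>\<^bsub>TA\<^esub> (c \<odot>\<^bsub>TA\<^esub> basis_vec K x) \<in> ker"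
    using relation_smult[OF assms xi] relations_subset_kernel by auto
  then show ?thesis
    using assms xi
    by (simp add: pure_tensor_def T.smult_coset T.coset_eq_iff update_tuple smult_factor_closed)
qed

text \<open>A single relation scales a single coordinate, so the scalars are extracted by induction
  on the set \<open>J\<close> of coordinates already scaled; \<open>?y J\<close> is the tuple at
  that stage.\<close>

lemma pure_smult:
  assumes x: "x \<in> tuples" and c: "c \<in> I \<rightarrow> carrier K"
  shows "pure (\<lambda>i\<in>I. c i \<odot>\<^bsub>F i\<^esub> x i) = (\<Otimes>i\<in>I. c i) \<odot>\<^bsub>tensor_algebra K I F\<^esub> pure x"
proof -
  interpret W: bilinear_algebra K "tensor_algebra K I F"
    by (rule T.bilinear_quotient)
  have xi: "i \<in> I \<Longrightarrow> x i \<in> carrier (F i)" for i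
    using x by (auto dest: PiE_mem)
  let ?y = "\<lambda>J. \<lambda>i\<in>I. if i \<in> J then c i \<odot>\<^bsub>F i\<^esub> x i else x i"
  have "pure (?y J) = (\<Otimes>i\<in>J. c i) \<odot>\<^bsub>tensor_algebra K I F\<^esub> pure x" if "J \<subseteq> I" for J
    using finite_subset[OF that finite_index] that
  proof (induction J)
    case empty
    have "?y {} = x"
      using x by (auto simp: PiE_def extensional_def fun_eq_iff)
    then show ?case
      using x by (simp add: pure_in_carrier)
  next
    case (insert j J)
    have y: "?y J \<in> tuples"
      using xi c by (auto intro!: smult_factor_closed)
    have j: "j \<in> I" "c j \<in> carrier K"
      using insert c by auto
    have cJ: "(\<Otimes>i\<in>J. c i) \<in> carrier K"
      using insert c by (intro finprod_closed) auto
    \<comment> \<open>Since \<open>j\<close> is not in \<open>J\<close>, coordinate \<open>j\<close>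
      of \<open>?y J\<close> is still \<open>x j\<close>.\<close>
    have "?y (insert j J) = (?y J)(j := c j \<odot>\<^bsub>F j\<^esub> ?y J j)"
      using insert j by (auto simp: fun_eq_iff)
    then have "pure (?y (insert j J)) = c j \<odot>\<^bsub>tensor_algebra K I F\<^esub> pure (?y J)"
      using pure_update_smult[OF y j] by simp
    also have "pure (?y J) = (\<Otimes>i\<in>J. c i) \<odot>\<^bsub>tensor_algebra K I F\<^esub> pure x"
      using insert.prems by (intro insert.IH) simp
    also have "c j \<odot>\<^bsub>tensor_algebra K I F\<^esub> \<dots> =
        (c j \<otimes> (\<Otimes>i\<in>J. c i)) \<odot>\<^bsub>tensor_algebra K I F\<^esub> pure x"
      using j cJ x by (intro W.smult_assoc1[symmetric] pure_in_carrier)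
    also have "c j \<otimes> (\<Otimes>i\<in>J. c i) = (\<Otimes>i\<in>insert j J. c i)"
      using insert j c by (subst finprod_insert) auto
    finally show ?case .
  qed
  from this[of I] show ?thesis
    by (simp cong: restrict_cong)
qed

text \<open>The product of linear functionals on the factors is multilinear in the tuple, so its
  linear extension to the free module vanishes on the relations. Its kernel thus contains
  \<open>ker\<close>, and the image of this kernel in the quotient is the witness.\<close>

lemma separating_submodule:
  assumes \<phi>: "\<And>i u. \<lbrakk>i \<in> I; u \<in> carrier (F i)\<rbrakk> \<Longrightarrow> \<phi> i u \<in> carrier K"
    and \<phi>_add: "\<And>i u v. \<lbrakk>i \<in> I; u \<in> carrier (F i); v \<in> carrier (F i)\<rbrakk>
      \<Longrightarrow> \<phi> i (u \<oplus>\<^bsub>F i\<^esub> v) = \<phi> i u \<oplus> \<phi> i v"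
    and \<phi>_smult: "\<And>i c u. \<lbrakk>i \<in> I; c \<in> carrier K; u \<in> carrier (F i)\<rbrakk>
      \<Longrightarrow> \<phi> i (c \<odot>\<^bsub>F i\<^esub> u) = c \<otimes> \<phi> i u"
  obtains S where "submodule K S (tensor_algebra K I F)"
    "\<And>x. x \<in> tuples \<Longrightarrow> pure x \<in> S \<longleftrightarrow> (\<Otimes>i\<in>I. \<phi> i (x i)) = \<zero>"
proof
  let ?h = "\<lambda>x. \<Otimes>i\<in>I. \<phi> i (x i)"
  let ?S = "{f \<in> carrier TA. T.linear_extension ?h f = \<zero>}"
  have xi: "x \<in> tuples \<Longrightarrow> i \<in> I \<Longrightarrow> x i \<in> carrier (F i)" for x i
    by (auto dest: PiE_mem)
  have h: "?h \<in> tuples \<rightarrow> carrier K"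
    by (intro funcsetI finprod_closed) (simp add: \<phi> xi)
  note lin = T.linear_extension_add[OF h] T.linear_extension_smult[OF h]
    T.linear_extension_basis_vec[OF h] T.linear_extension_minus[OF h]
  \<comment> \<open>Splitting off the factor at \<open>i\<close> exhibits linearity in coordinate
    \<open>i\<close>: the remaining product does not depend on the new entry.\<close>
  have split: "?h (x(i := u)) = \<phi> i u \<otimes> (\<Otimes>j\<in>I - {i}. \<phi> j (x j))"
    and rest: "(\<Otimes>j\<in>I - {i}. \<phi> j (x j)) \<in> carrier K"
    if "x \<in> tuples" "i \<in> I" "u \<in> carrier (F i)" for x i u
  proof -
    have "?h (x(i := u)) = (\<Otimes>j\<in>insert i (I - {i}). \<phi> j ((x(i := u)) j))"
      using that by (simp add: insert_absorb)
    also have "\<dots> = \<phi> i ((x(i := u)) i) \<otimes> (\<Otimes>j\<in>I - {i}. \<phi> j ((x(i := u)) j))"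
      using finite_index that xi[OF that(1)] by (intro finprod_insert) (auto simp: \<phi>)
    also have "(\<Otimes>j\<in>I - {i}. \<phi> j ((x(i := u)) j)) = (\<Otimes>j\<in>I - {i}. \<phi> j (x j))"
      using xi[OF that(1)] by (intro finprod_cong') (auto simp: \<phi>)
    finally show "?h (x(i := u)) = \<phi> i u \<otimes> (\<Otimes>j\<in>I - {i}. \<phi> j (x j))"
      by simp
    show "(\<Otimes>j\<in>I - {i}. \<phi> j (x j)) \<in> carrier K"
      using xi[OF that(1)] by (intro finprod_closed) (auto simp: \<phi>)
  qed
  have sub: "submodule K ?S TA"
    by (rule T.kernel_submodule[OF h])
  have "\<rho> \<in> ?S" if "\<rho> \<in> relations" for \<rho>
    using that
  proof (cases rule: relation_cases)
    case (add x i u v)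
    have "T.linear_extension ?h \<rho> = ?h (x(i := u \<oplus>\<^bsub>F i\<^esub> v)) \<ominus> (?h (x(i := u)) \<oplus> ?h (x(i := v)))"
      using add by (simp add: lin update_tuple add_factor_closed del: fun_upd_apply)
    also have "\<dots> = \<zero>"
      using add rest[OF add(1-3)]
      by (simp add: split add_factor_closed \<phi> \<phi>_add l_distr r_neg minus_eq del: fun_upd_apply)
    finally show ?thesis
      using that relations_in_carrier by blast
  next
    case (smult x i c u)
    have "T.linear_extension ?h \<rho> = ?h (x(i := c \<odot>\<^bsub>F i\<^esub> u)) \<ominus> c \<otimes> ?h (x(i := u))"
      using smult by (simp add: lin update_tuple smult_factor_closed del: fun_upd_apply)
    also have "\<dots> = \<zero>"
      using smult rest[OF smult(1,2,4)]
      by (simp add: split smult_factor_closed \<phi> \<phi>_smult m_assoc r_neg minus_eq del: fun_upd_apply)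
    finally show ?thesis
      using that relations_in_carrier by blast
  qed
  then have ker: "ker \<subseteq> ?S"
    using kernel_subset_submodule[OF sub] by blast
  show "submodule K ((\<lambda>f. ker +>\<^bsub>TA\<^esub> f) ` ?S) (tensor_algebra K I F)"
    using sub by (rule T.submodule_image_coset)
  fix x assume x: "x \<in> tuples"
  show "pure x \<in> (\<lambda>f. ker +>\<^bsub>TA\<^esub> f) ` ?S \<longleftrightarrow> ?h x = \<zero>"
  proof
    assume "pure x \<in> (\<lambda>f. ker +>\<^bsub>TA\<^esub> f) ` ?S"
    then obtain f where f: "f \<in> ?S" "ker +>\<^bsub>TA\<^esub> basis_vec K x = ker +>\<^bsub>TA\<^esub> f"
      unfolding pure_tensor_def by blast
    \<comment> \<open>Representatives of one coset differ by an element of \<open>ker\<close>, hence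
      of \<open>?S\<close>. As the functional also vanishes on \<open>f\<close>, it vanishes on the
      basis vector of \<open>x\<close>.\<close>
    then have "basis_vec K x \<ominus>\<^bsub>TA\<^esub> f \<in> ?S"
      using ker x by (auto simp: T.coset_eq_iff)
    then have "?h x \<ominus> \<zero> = \<zero>"
      using f x by (simp add: lin)
    then show "?h x = \<zero>"
      using h x by (simp add: minus_eq Pi_iff)
  next
    assume "?h x = \<zero>"
    then show "pure x \<in> (\<lambda>f. ker +>\<^bsub>TA\<^esub> f) ` ?S"
      using x by (auto simp: pure_tensor_def lin)
  qed
qed

end

section \<open>Tensor products of diagrams\<close>

lemma twisted_partition_algebra:
  assumes "field K" "q \<in> carrier K"
  shows "twisted K (diagrams n) (diagram_id n) (diagram_comp n) (\<lambda>a b. q [^]\<^bsub>K\<^esub> inner_parts n a b)"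
proof -
  interpret field K by fact
  show ?thesis
    using assms(2) by unfold_locales (auto simp: diagram_id_in_diagrams diagram_comp_in_diagrams)
qed

locale partition_family = field K for K (structure) +
  fixes n :: nat and T :: "'i set" and Q :: "'i \<Rightarrow> 'a"
  assumes finite_T: "finite T" and Q: "t \<in> T \<Longrightarrow> Q t \<in> carrier K"
begin

sublocale tensor_family K T "\<lambda>t. partition_algebra K n (Q t)"
proof (intro tensor_family.intro tensor_family_axioms.intro field_axioms)
  show "finite T" by (rule finite_T)
  show "bilinear_algebra K (partition_algebra K n (Q t))" if "t \<in> T" for t
    unfolding partition_algebra_def
    using twisted_partition_algebra[OF field_axioms Q[OF that]] by (rule twisted.bilinear)
qed

abbreviation "D \<equiv> diagram_tensor K n T Q"

lemma partition_algebra_carrier: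
  "t \<in> T \<Longrightarrow> f \<in> carrier (partition_algebra K n (Q t)) \<longleftrightarrow>
    (\<forall>x. f x \<in> carrier K) \<and> finite (supp K f) \<and> supp K f \<subseteq> diagrams n"
  unfolding partition_algebra_def
  using twisted_partition_algebra[OF field_axioms Q] by (rule twisted.in_carrier_iff)

lemma diagram_tuple:
  assumes "a \<in> T \<rightarrow> diagrams n"
  shows "(\<lambda>t\<in>T. basis_vec K (a t)) \<in> tuples"
  using assms by (auto simp: partition_algebra_carrier T.supp_bv T.basis_vec_apply)

text \<open>Each factor contributes its own power of its parameter, and \<open>pure_smult\<close>
  collects these in front of the tensor.\<close>

lemma diagram_tensor_mult:
  assumes a: "a \<in> T \<rightarrow> diagrams n" and b: "b \<in> T \<rightarrow> diagrams n"
  shows "D a \<otimes>\<^bsub>tensor_algebra K T (\<lambda>t. partition_algebra K n (Q t))\<^esub> D b =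
    (\<Otimes>t\<in>T. Q t [^] inner_parts n (a t) (b t))
      \<odot>\<^bsub>tensor_algebra K T (\<lambda>t. partition_algebra K n (Q t))\<^esub> D (\<lambda>t\<in>T. diagram_comp n (a t) (b t))"
proof -
  have c: "(\<lambda>t\<in>T. diagram_comp n (a t) (b t)) \<in> T \<rightarrow> diagrams n"
    using a b by (auto intro: diagram_comp_in_diagrams)
  show ?thesis
    unfolding diagram_tensor_def pure_mult[OF diagram_tuple[OF a] diagram_tuple[OF b]] tuple_mult_def
    using Q by (subst pure_smult[OF diagram_tuple[OF c], symmetric])
      (auto simp: partition_algebra_mult_basis field_axioms intro!: arg_cong[where f = pure] restrict_ext)
qed

lemma one_eq_diagram_tensor:
  "\<one>\<^bsub>tensor_algebra K T (\<lambda>t. partition_algebra K n (Q t))\<^esub> = D (\<lambda>t\<in>T. diagram_id n)"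
  unfolding one_eq_pure diagram_tensor_def
  by (intro arg_cong[where f = pure] restrict_ext) (simp add: partition_algebra_def twisted_algebra_def)

text \<open>The product of the coordinate functionals at the diagrams \<open>a t\<close> vanishes on the tensor product
  of every other family of diagrams.\<close>

lemma diagram_tensor_separated:
  assumes a: "a \<in> T \<rightarrow>\<^sub>E diagrams n"
  obtains S where "submodule K S (tensor_algebra K T (\<lambda>t. partition_algebra K n (Q t)))"
    "\<And>b. b \<in> T \<rightarrow>\<^sub>E diagrams n \<Longrightarrow> D b \<in> S \<longleftrightarrow> b \<noteq> a"
proof -
  obtain S where S: "submodule K S (tensor_algebra K T (\<lambda>t. partition_algebra K n (Q t)))"
    and mem: "\<And>x. x \<in> tuples \<Longrightarrow> pure x \<in> S \<longleftrightarrow> (\<Otimes>t\<in>T. x t (a t)) = \<zero>"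
  proof (rule separating_submodule[of "\<lambda>t u. u (a t)"])
    show "u (a t) \<in> carrier K" if "t \<in> T" "u \<in> carrier (partition_algebra K n (Q t))" for t u
      using that by (simp add: partition_algebra_carrier)
  qed (simp_all add: partition_algebra_def twisted_algebra_def)
  have "D b \<in> S \<longleftrightarrow> b \<noteq> a" if b: "b \<in> T \<rightarrow>\<^sub>E diagrams n" for b
  proof -
    have "(\<Otimes>t\<in>T. (\<lambda>t\<in>T. basis_vec K (b t)) t (a t)) = (\<Otimes>t\<in>T. if a t = b t then \<one> else \<zero>)"
      by (intro finprod_cong') (auto simp: basis_vec_def)
    moreover have "(\<lambda>t\<in>T. basis_vec K (b t)) \<in> tuples"
      using b by (intro diagram_tuple) auto
    ultimately have "D b \<in> S \<longleftrightarrow> (\<Otimes>t\<in>T. if a t = b t then \<one> else \<zero>) = \<zero>"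
      unfolding diagram_tensor_def by (simp only: mem)
    also have "\<dots> \<longleftrightarrow> b \<noteq> a"
    proof (cases "b = a")
      case False
      \<comment> \<open>Distinct extensional tuples differ at some index in \<open>T\<close>, and
        the factor at that index is 0.\<close>
      then obtain t where t: "t \<in> T" "a t \<noteq> b t"
        using a b by (metis PiE_ext)
      have "(\<Otimes>s\<in>insert t (T - {t}). if a s = b s then \<one> else \<zero>) =
          (if a t = b t then \<one> else \<zero>) \<otimes> (\<Otimes>s\<in>T - {t}. if a s = b s then \<one> else \<zero>)"
        using finite_T by (intro finprod_insert) auto
      also have "\<dots> = \<zero>"
        using t by (simp add: finprod_closed Pi_def)
      finally show ?thesis
        using t False by (simp add: insert_absorb)
    qed simp
    finally show ?thesis .
  qed
  with S show thesis
    by (rule that)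
qed

end

theorem proposition2:
  fixes K :: "('k, 'm) ring_scheme" and n d :: nat and r :: "nat rel" and Q :: "nat \<Rightarrow> 'k"
  assumes "field K"
    and "partial_order_on {1..d} r"
    and "\<And>t. t \<in> {1..d} \<Longrightarrow> Q t \<in> carrier K"
  shows "let W = tensor_algebra K {1..d} (\<lambda>t. partition_algebra K n (Q t));
             P = diagram_tensor K n {1..d} Q ` ramified n {1..d} r
         in inj_on (diagram_tensor K n {1..d} Q) (ramified n {1..d} r) \<and>
            (\<exists>B. is_subalgebra K B W \<and> vectorspace.basis K (W\<lparr>carrier := B\<rparr>) P)"
proof -
  interpret partition_family K n "{1..d}" Q
    using assms by (intro partition_family.intro partition_family_axioms.intro) auto
  let ?W = "tensor_algebra K {1..d} (\<lambda>t. partition_algebra K n (Q t))"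
  let ?R = "ramified n {1..d} r"
  have R: "a \<in> {1..d} \<rightarrow>\<^sub>E diagrams n" if "a \<in> ?R" for a
    using that by (simp add: ramified_iff)
  have "inj_on D ?R"
  proof (rule inj_onI, rule ccontr)
    fix a b assume ab: "a \<in> ?R" "b \<in> ?R" "D a = D b" "a \<noteq> b"
    \<comment> \<open>The submodule attached to \<open>a\<close> contains \<open>D b\<close> but not
      \<open>D a\<close>, although the two are assumed equal.\<close>
    obtain S where "\<And>b. b \<in> {1..d} \<rightarrow>\<^sub>E diagrams n \<Longrightarrow> D b \<in> S \<longleftrightarrow> b \<noteq> a"
      by (rule diagram_tensor_separated[OF R[OF ab(1)]], rule that)
    then show False
      using ab R by metis
  qed
  moreover have "\<exists>B. is_subalgebra K B ?W \<and> vectorspace.basis K (?W\<lparr>carrier := B\<rparr>) (D ` ?R)"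
  proof (rule span_subalgebra_with_basis)
    show "field K" by (rule field_axioms)
    show "bilinear_algebra K ?W" by (rule T.bilinear_quotient)
    show "D ` ?R \<subseteq> carrier ?W"
      unfolding diagram_tensor_def
      using R by (intro image_subsetI pure_in_carrier diagram_tuple) auto
    show "\<one>\<^bsub>?W\<^esub> \<in> D ` ?R"
      unfolding one_eq_diagram_tensor by (intro imageI ramified_diagram_id)
  next
    fix x y assume "x \<in> D ` ?R" "y \<in> D ` ?R"
    then obtain a b where ab: "a \<in> ?R" "x = D a" "b \<in> ?R" "y = D b"
      by blast
    have "x \<otimes>\<^bsub>?W\<^esub> y = (\<Otimes>\<^bsub>K\<^esub>t\<in>{1..d}. Q t [^]\<^bsub>K\<^esub> inner_parts n (a t) (b t))
        \<odot>\<^bsub>?W\<^esub> D (\<lambda>t\<in>{1..d}. diagram_comp n (a t) (b t))"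
      unfolding ab(2,4) using R[OF ab(1)] R[OF ab(3)] by (intro diagram_tensor_mult) auto
    moreover have "(\<Otimes>\<^bsub>K\<^esub>t\<in>{1..d}. Q t [^]\<^bsub>K\<^esub> inner_parts n (a t) (b t)) \<in> carrier K"
      using Q by (intro finprod_closed) auto
    ultimately show "\<exists>c\<in>carrier K. \<exists>z\<in>D ` ?R. x \<otimes>\<^bsub>?W\<^esub> y = c \<odot>\<^bsub>?W\<^esub> z"
      using ramified_diagram_comp[OF ab(1,3)] by blast
  next
    fix p assume "p \<in> D ` ?R"
    then obtain a where a: "a \<in> ?R" "p = D a"
      by blast
    obtain S where S: "submodule K S ?W"
      "\<And>b. b \<in> {1..d} \<rightarrow>\<^sub>E diagrams n \<Longrightarrow> D b \<in> S \<longleftrightarrow> b \<noteq> a"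
      by (rule diagram_tensor_separated[OF R[OF a(1)]], rule that)
    \<comment> \<open>A member of the image other than \<open>p\<close> is \<open>D b\<close> for
      some \<open>b\<close> distinct from \<open>a\<close>, while \<open>p\<close> is the case
      \<open>b\<close> = \<open>a\<close>.\<close>
    then have "D ` ?R - {p} \<subseteq> S" "p \<notin> S"
      using a R by auto
    with S(1) show "\<exists>N. submodule K N ?W \<and> D ` ?R - {p} \<subseteq> N \<and> p \<notin> N"
      by blast
  qed
  ultimately show ?thesis
    by (simp only: Let_def simp_thms)
qed

end
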